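(* Let $R$ be a commutative ring with $1$, let $(A,\{\cdot,\cdot\})$ be a representable Poisson algebra over $R$, and let $M$ be a projective rank one $A$-module together with a $D_{\{\cdot,\cdot\}}$-connection $\nabla\colon D_{\{\cdot,\cdot\}}\to\mathrm{End}(M)$ with curvature $-\pi_{\{\cdot,\cdot\}}$. Then the composite of $$\iota_{\{\cdot,\cdot\}}\colon A\to \bar L_{\{\cdot,\cdot\}},\qquad a\mapsto (a,da),$$ with the flat $\bar L_{\{\cdot,\cdot\}}$-connection $\bar L_{\{\cdot,\cdot\}}\to\mathrm{End}(M)$, $(a,\alpha)\mapsto (x\mapsto ax+\nabla_\alpha x)$, on $M$ is a representation of the $R$-Lie algebra underlying $A$ on $M$, viewed as an $R$-module, having the property that the elements of $R$ act by multiplication. Explicitly, the representation is given by $a\mapsto\hat a$ where, for $a\in A$, $\hat a$ is the operator $$\hat a\,x=\nabla_{da}x+ax,\qquad x\in M.$$ When the form $\pi_{\{\cdot,\cdot\}}$ is non-degenerate, the representation is faithful.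
   Context: A Poisson algebra over $R$ is a commutative $R$-algebra $A$ with a Lie bracket over $R$ satisfying $\{ab,c\}=a\{b,c\}+\{a,c\}b$. $D_A$ is the $A$-module of Kähler differentials of $A$ over $R$. $\pi=\pi_{\{\cdot,\cdot\}}\colon D_A\otimes_AD_A\to A$ is the alternating form $\pi(a\,du,b\,dv)=ab\{u,v\}$; it is called non-degenerate if its adjoint $\pi^\sharp\colon D_A\to\mathrm{Hom}_A(D_A,A)=\mathrm{Der}(A)$, $a\,du\mapsto a\{u,-\}$, is injective. $D_{\{\cdot,\cdot\}}$ is $D_A$ with Lie bracket $[a\,du,b\,dv]=a\{u,b\}dv+b\{a,v\}du+ab\,d\{u,v\}$ and action on $A$ by derivations $(a\,du)(c)=a\{u,c\}$; it is an $(R,A)$-Lie algebra, i.e. an $R$-Lie algebra $L$ that is an $A$-module acting on $A$ by derivations, with $(a\alpha)(b)=a\alpha(b)$ and $[\alpha,a\beta]=a[\alpha,\beta]+\alpha(a)\beta$. For an $(R,A)$-Lie algebra $L$ and an $A$-module $M$, an $L$-connection on $M$ is an $R$-linear map $\nabla\colon L\to\mathrm{End}_R(M)$ with $\nabla_{a\alpha}m=a\nabla_\alpha m$ and $\nabla_\alpha(am)=\alpha(a)m+a\nabla_\alpha m$. Its curvature is the $A$-bilinear alternating form $\Omega(\alpha,\beta)=\nabla_\alpha\nabla_\beta-\nabla_\beta\nabla_\alpha-\nabla_{[\alpha,\beta]}$ on $L$ with values in $\mathrm{End}_A(M)$; it is flat if $\Omega=0$. For $M$ projective of rank one, $\mathrm{End}_A(M)\cong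 A$ canonically, so the curvature is $A$-valued. $(A,\{\cdot,\cdot\})$ is representable if there is a projective rank one $A$-module with a $D_{\{\cdot,\cdot\}}$-connection of curvature $-\pi_{\{\cdot,\cdot\}}$. $\bar L_{\{\cdot,\cdot\}}=A\oplus D_A$ as an $A$-module, with $A$ an abelian ideal, $[(0,\alpha),(0,\beta)]=(-\pi_{\{\cdot,\cdot\}}(\alpha,\beta),[\alpha,\beta])$, $[(a,0),(0,\alpha)]=(-\alpha(a),0)$, acting on $A$ through the projection to $D_{\{\cdot,\cdot\}}$; it is an $(R,A)$-Lie algebra. *)

theory Defs
  imports "HOL-Algebra.Module" "HOL-Algebra.Ideal"
begin

section \<open>Modules\<close>

text \<open>
  An \<open>A\<close>-module is a record \<open>M\<close> with \<open>module A M\<close>. The record type has ring fields \<open>mult\<close> and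
  \<open>one\<close>, which carry no meaning for a module and are left \<open>undefined\<close> below.
\<close>

definition linear_maps ::
    "('r, 'x) ring_scheme \<Rightarrow> ('r, 'v, 'y) module_scheme \<Rightarrow> ('r, 'w, 'z) module_scheme \<Rightarrow> ('v \<Rightarrow> 'w) set"
  where "linear_maps R V W =
    {f \<in> carrier V \<rightarrow> carrier W.
      (\<forall>x\<in>carrier V. \<forall>y\<in>carrier V. f (x \<oplus>\<^bsub>V\<^esub> y) = f x \<oplus>\<^bsub>W\<^esub> f y) \<and>
      (\<forall>r\<in>carrier R. \<forall>x\<in>carrier V. f (r \<odot>\<^bsub>V\<^esub> x) = r \<odot>\<^bsub>W\<^esub> f x)}"

text \<open>For an \<open>R\<close>-algebra \<open>A\<close> and an \<open>A\<close>-module \<open>M\<close>: the \<open>R\<close>-module underlying \<open>M\<close>.\<close>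

definition restrict_scalars ::
    "('r, 'a, 'x) module_scheme \<Rightarrow> ('a, 'm, 'y) module_scheme \<Rightarrow> ('r, 'm) module"
  where "restrict_scalars A M =
    \<lparr>carrier = carrier M, mult = undefined, one = undefined, zero = \<zero>\<^bsub>M\<^esub>, add = add M,
     smult = (\<lambda>r x. (r \<odot>\<^bsub>A\<^esub> \<one>\<^bsub>A\<^esub>) \<odot>\<^bsub>M\<^esub> x)\<rparr>"

definition generated_submodule ::
    "('a, 'x) ring_scheme \<Rightarrow> ('a, 'm, 'y) module_scheme \<Rightarrow> 'm set \<Rightarrow> 'm set"
  where "generated_submodule A M S = \<Inter>{N. submodule N A M \<and> S \<subseteq> N}"

definition quotient_module :: "('a, 'm, 'y) module_scheme \<Rightarrow> 'm set \<Rightarrow> ('a, 'm set) module"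
  where "quotient_module M N =
    \<lparr>carrier = a_rcosets\<^bsub>M\<^esub> N, mult = undefined, one = undefined, zero = N, add = set_add M,
     smult = (\<lambda>a X. \<Union>x\<in>X. N +>\<^bsub>M\<^esub> (a \<odot>\<^bsub>M\<^esub> x))\<rparr>"

text \<open>The free module on \<open>I\<close>, as finitely supported families \<open>I \<rightarrow> A\<close> (set to zero outside \<open>I\<close>).\<close>

definition free_module :: "('a, 'x) ring_scheme \<Rightarrow> 'i set \<Rightarrow> ('a, 'i \<Rightarrow> 'a) module"
  where "free_module A I =
    \<lparr>carrier = {f. (\<forall>i\<in>I. f i \<in> carrier A) \<and> (\<forall>i. i \<notin> I \<longrightarrow> f i = \<zero>\<^bsub>A\<^esub>) \<and> finite {i. f i \<noteq> \<zero>\<^bsub>A\<^esub>}},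
     mult = undefined, one = undefined, zero = (\<lambda>i. \<zero>\<^bsub>A\<^esub>),
     add = (\<lambda>f g i. f i \<oplus>\<^bsub>A\<^esub> g i), smult = (\<lambda>a f i. a \<otimes>\<^bsub>A\<^esub> f i)\<rparr>"

definition basis_vector :: "('a, 'x) ring_scheme \<Rightarrow> 'i \<Rightarrow> 'i \<Rightarrow> 'a"
  where "basis_vector A i = (\<lambda>j. if j = i then \<one>\<^bsub>A\<^esub> else \<zero>\<^bsub>A\<^esub>)"

definition free_of_rank :: "('a, 'x) ring_scheme \<Rightarrow> ('a, 'm, 'y) module_scheme \<Rightarrow> nat \<Rightarrow> bool"
  where "free_of_rank A M n \<longleftrightarrow>
    (\<exists>\<phi>\<in>linear_maps A (free_module A {..<n}) M.
      bij_betw \<phi> (carrier (free_module A {..<n})) (carrier M))"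


section \<open>Localisation and projective modules of rank one\<close>

text \<open>The fraction \<open>m/s\<close>, as a class of pairs, for a multiplicative subset \<open>S\<close> of \<open>A\<close>.\<close>

definition fraction ::
    "'a set \<Rightarrow> ('a, 'm, 'y) module_scheme \<Rightarrow> 'm \<Rightarrow> 'a \<Rightarrow> ('m \<times> 'a) set"
  where "fraction S M m s =
    {(m', s'). m' \<in> carrier M \<and> s' \<in> S \<and>
      (\<exists>t\<in>S. t \<odot>\<^bsub>M\<^esub> (s' \<odot>\<^bsub>M\<^esub> m) = t \<odot>\<^bsub>M\<^esub> (s \<odot>\<^bsub>M\<^esub> m'))}"

definition regular_module :: "('a, 'x) ring_scheme \<Rightarrow> ('a, 'a) module"
  where "regular_module A =
    \<lparr>carrier = carrier A, mult = mult A, one = \<one>\<^bsub>A\<^esub>, zero = \<zero>\<^bsub>A\<^esub>, add = add A, smult = mult A\<rparr>"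

definition localized_ring :: "('a, 'x) ring_scheme \<Rightarrow> 'a set \<Rightarrow> ('a \<times> 'a) set ring"
  where "localized_ring A S =
    \<lparr>carrier = {fraction S (regular_module A) a s | a s. a \<in> carrier A \<and> s \<in> S},
     mult = (\<lambda>X Y. \<Union>(a, s)\<in>X. \<Union>(b, t)\<in>Y. fraction S (regular_module A) (a \<otimes>\<^bsub>A\<^esub> b) (s \<otimes>\<^bsub>A\<^esub> t)),
     one = fraction S (regular_module A) \<one>\<^bsub>A\<^esub> \<one>\<^bsub>A\<^esub>,
     zero = fraction S (regular_module A) \<zero>\<^bsub>A\<^esub> \<one>\<^bsub>A\<^esub>,
     add = (\<lambda>X Y. \<Union>(a, s)\<in>X. \<Union>(b, t)\<in>Y.
       fraction S (regular_module A) ((t \<otimes>\<^bsub>A\<^esub> a) \<oplus>\<^bsub>A\<^esub> (s \<otimes>\<^bsub>A\<^esub> b)) (s \<otimes>\<^bsub>A\<^esub> t))\<rparr>"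

definition localized_module ::
    "('a, 'x) ring_scheme \<Rightarrow> 'a set \<Rightarrow> ('a, 'm, 'y) module_scheme \<Rightarrow> (('a \<times> 'a) set, ('m \<times> 'a) set) module"
  where "localized_module A S M =
    \<lparr>carrier = {fraction S M m s | m s. m \<in> carrier M \<and> s \<in> S},
     mult = undefined, one = undefined,
     zero = fraction S M \<zero>\<^bsub>M\<^esub> \<one>\<^bsub>A\<^esub>,
     add = (\<lambda>X Y. \<Union>(m, s)\<in>X. \<Union>(n, t)\<in>Y.
       fraction S M ((t \<odot>\<^bsub>M\<^esub> m) \<oplus>\<^bsub>M\<^esub> (s \<odot>\<^bsub>M\<^esub> n)) (s \<otimes>\<^bsub>A\<^esub> t)),
     smult = (\<lambda>X Y. \<Union>(a, s)\<in>X. \<Union>(m, t)\<in>Y. fraction S M (a \<odot>\<^bsub>M\<^esub> m) (s \<otimes>\<^bsub>A\<^esub> t))\<rparr>"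

text \<open>
  Projective means direct summand of a free module. Every module is a quotient of the free
  module on its own carrier, so index sets inside the type \<open>'m\<close> suffice.
\<close>

definition projective_module :: "('a, 'x) ring_scheme \<Rightarrow> ('a, 'm, 'y) module_scheme \<Rightarrow> bool"
  where "projective_module A M \<longleftrightarrow> module A M \<and>
    (\<exists>I :: 'm set. \<exists>i\<in>linear_maps A M (free_module A I). \<exists>p\<in>linear_maps A (free_module A I) M.
      \<forall>x\<in>carrier M. p (i x) = x)"

definition finitely_generated_module :: "('a, 'x) ring_scheme \<Rightarrow> ('a, 'm, 'y) module_scheme \<Rightarrow> bool"
  where "finitely_generated_module A M \<longleftrightarrow>
    (\<exists>S. finite S \<and> S \<subseteq> carrier M \<and> generated_submodule A M S = carrier M)"

definition projective_rank_one :: "('a, 'x) ring_scheme \<Rightarrow> ('a, 'm, 'y) module_scheme \<Rightarrow> bool"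
  where "projective_rank_one A M \<longleftrightarrow>
    projective_module A M \<and> finitely_generated_module A M \<and>
    (\<forall>P. primeideal P A \<longrightarrow>
      free_of_rank (localized_ring A (carrier A - P)) (localized_module A (carrier A - P) M) 1)"


section \<open>Lie and Poisson algebras\<close>

locale lie_algebra = module R L for R (structure) and L (structure) +
  fixes br :: "'c \<Rightarrow> 'c \<Rightarrow> 'c"
  assumes br_closed: "\<lbrakk>x \<in> carrier L; y \<in> carrier L\<rbrakk> \<Longrightarrow> br x y \<in> carrier L"
    and br_add_left: "\<lbrakk>x \<in> carrier L; y \<in> carrier L; z \<in> carrier L\<rbrakk>
      \<Longrightarrow> br (x \<oplus>\<^bsub>L\<^esub> y) z = br x z \<oplus>\<^bsub>L\<^esub> br y z"
    and br_add_right: "\<lbrakk>x \<in> carrier L; y \<in> carrier L; z \<in> carrier L\<rbrakk>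
      \<Longrightarrow> br x (y \<oplus>\<^bsub>L\<^esub> z) = br x y \<oplus>\<^bsub>L\<^esub> br x z"
    and br_smult_left: "\<lbrakk>r \<in> carrier R; x \<in> carrier L; y \<in> carrier L\<rbrakk>
      \<Longrightarrow> br (r \<odot>\<^bsub>L\<^esub> x) y = r \<odot>\<^bsub>L\<^esub> br x y"
    and br_smult_right: "\<lbrakk>r \<in> carrier R; x \<in> carrier L; y \<in> carrier L\<rbrakk>
      \<Longrightarrow> br x (r \<odot>\<^bsub>L\<^esub> y) = r \<odot>\<^bsub>L\<^esub> br x y"
    and br_self: "x \<in> carrier L \<Longrightarrow> br x x = \<zero>\<^bsub>L\<^esub>"
    and jacobi: "\<lbrakk>x \<in> carrier L; y \<in> carrier L; z \<in> carrier L\<rbrakk>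
      \<Longrightarrow> br x (br y z) \<oplus>\<^bsub>L\<^esub> br y (br z x) \<oplus>\<^bsub>L\<^esub> br z (br x y) = \<zero>\<^bsub>L\<^esub>"

locale poisson_algebra = algebra R A + lie_algebra R A pb
  for R (structure) and A (structure) and pb +
  assumes leibniz: "\<lbrakk>a \<in> carrier A; b \<in> carrier A; c \<in> carrier A\<rbrakk>
    \<Longrightarrow> pb (a \<otimes>\<^bsub>A\<^esub> b) c = (a \<otimes>\<^bsub>A\<^esub> pb b c) \<oplus>\<^bsub>A\<^esub> (pb a c \<otimes>\<^bsub>A\<^esub> b)"

text \<open>\<open>\<rho>\<close> is a morphism of \<open>R\<close>-Lie algebras from \<open>(L, br)\<close> to \<open>End\<^sub>R(V)\<close> with the commutator bracket.\<close>

definition lie_representation ::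
    "('r, 'x) ring_scheme \<Rightarrow> ('r, 'l, 'y) module_scheme \<Rightarrow> ('l \<Rightarrow> 'l \<Rightarrow> 'l)
      \<Rightarrow> ('r, 'v, 'z) module_scheme \<Rightarrow> ('l \<Rightarrow> 'v \<Rightarrow> 'v) \<Rightarrow> bool"
  where "lie_representation R L br V \<rho> \<longleftrightarrow>
    (\<forall>a\<in>carrier L. \<rho> a \<in> linear_maps R V V) \<and>
    (\<forall>a\<in>carrier L. \<forall>b\<in>carrier L. \<forall>x\<in>carrier V. \<rho> (a \<oplus>\<^bsub>L\<^esub> b) x = \<rho> a x \<oplus>\<^bsub>V\<^esub> \<rho> b x) \<and>
    (\<forall>r\<in>carrier R. \<forall>a\<in>carrier L. \<forall>x\<in>carrier V. \<rho> (r \<odot>\<^bsub>L\<^esub> a) x = r \<odot>\<^bsub>V\<^esub> \<rho> a x) \<and>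
    (\<forall>a\<in>carrier L. \<forall>b\<in>carrier L. \<forall>x\<in>carrier V. \<rho> (br a b) x = \<rho> a (\<rho> b x) \<ominus>\<^bsub>V\<^esub> \<rho> b (\<rho> a x))"

definition faithful ::
    "('r, 'l, 'y) module_scheme \<Rightarrow> ('r, 'v, 'z) module_scheme \<Rightarrow> ('l \<Rightarrow> 'v \<Rightarrow> 'v) \<Rightarrow> bool"
  where "faithful L V \<rho> \<longleftrightarrow> inj_on (\<lambda>a. restrict (\<rho> a) (carrier V)) (carrier L)"


section \<open>Kaehler differentials\<close>

definition kaehler_relations ::
    "('r, 'x) ring_scheme \<Rightarrow> ('r, 'a, 'y) module_scheme \<Rightarrow> ('a \<Rightarrow> 'a) set"
  where "kaehler_relations R A =
    (let F = free_module A (carrier A); \<delta> = basis_vector A in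
      {\<delta> (u \<oplus>\<^bsub>A\<^esub> v) \<ominus>\<^bsub>F\<^esub> (\<delta> u \<oplus>\<^bsub>F\<^esub> \<delta> v) | u v. u \<in> carrier A \<and> v \<in> carrier A} \<union>
      {\<delta> (r \<odot>\<^bsub>A\<^esub> u) \<ominus>\<^bsub>F\<^esub> ((r \<odot>\<^bsub>A\<^esub> \<one>\<^bsub>A\<^esub>) \<odot>\<^bsub>F\<^esub> \<delta> u) | r u. r \<in> carrier R \<and> u \<in> carrier A} \<union>
      {\<delta> (u \<otimes>\<^bsub>A\<^esub> v) \<ominus>\<^bsub>F\<^esub> ((u \<odot>\<^bsub>F\<^esub> \<delta> v) \<oplus>\<^bsub>F\<^esub> (v \<odot>\<^bsub>F\<^esub> \<delta> u)) | u v. u \<in> carrier A \<and> v \<in> carrier A})"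

definition kaehler_kernel ::
    "('r, 'x) ring_scheme \<Rightarrow> ('r, 'a, 'y) module_scheme \<Rightarrow> ('a \<Rightarrow> 'a) set"
  where "kaehler_kernel R A =
    generated_submodule A (free_module A (carrier A)) (kaehler_relations R A)"

definition kaehler ::
    "('r, 'x) ring_scheme \<Rightarrow> ('r, 'a, 'y) module_scheme \<Rightarrow> ('a, ('a \<Rightarrow> 'a) set) module"
  where "kaehler R A = quotient_module (free_module A (carrier A)) (kaehler_kernel R A)"

definition kaehler_d ::
    "('r, 'x) ring_scheme \<Rightarrow> ('r, 'a, 'y) module_scheme \<Rightarrow> 'a \<Rightarrow> ('a \<Rightarrow> 'a) set"
  where "kaehler_d R A u = kaehler_kernel R A +>\<^bsub>free_module A (carrier A)\<^esub> basis_vector A u"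

text \<open>
  A family \<open>f\<close> in a coset \<open>\<alpha>\<close> presents \<open>\<alpha>\<close> as the finite sum of the \<open>f u du\<close>. The form, the action
  and the bracket are the biadditive (resp. additive) extensions of their formulas on
  generators \<open>a du\<close>, evaluated on such presentations; the value does not depend on the
  presentation, and \<open>the_elem\<close> extracts it.
\<close>

definition support :: "('a, 'x) ring_scheme \<Rightarrow> ('a \<Rightarrow> 'a) \<Rightarrow> 'a set"
  where "support A f = {u \<in> carrier A. f u \<noteq> \<zero>\<^bsub>A\<^esub>}"

definition poisson_form ::
    "('r, 'a, 'y) module_scheme \<Rightarrow> ('a \<Rightarrow> 'a \<Rightarrow> 'a) \<Rightarrow> ('a \<Rightarrow> 'a) set \<Rightarrow> ('a \<Rightarrow> 'a) set \<Rightarrow> 'a"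
  where "poisson_form A pb \<alpha> \<beta> =
    the_elem ((\<lambda>(f, g). \<Oplus>\<^bsub>A\<^esub>u\<in>support A f. \<Oplus>\<^bsub>A\<^esub>v\<in>support A g. (f u \<otimes>\<^bsub>A\<^esub> g v) \<otimes>\<^bsub>A\<^esub> pb u v) ` (\<alpha> \<times> \<beta>))"

definition poisson_action ::
    "('r, 'a, 'y) module_scheme \<Rightarrow> ('a \<Rightarrow> 'a \<Rightarrow> 'a) \<Rightarrow> ('a \<Rightarrow> 'a) set \<Rightarrow> 'a \<Rightarrow> 'a"
  where "poisson_action A pb \<alpha> c =
    the_elem ((\<lambda>f. \<Oplus>\<^bsub>A\<^esub>u\<in>support A f. f u \<otimes>\<^bsub>A\<^esub> pb u c) ` \<alpha>)"

definition poisson_bracket ::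
    "('r, 'x) ring_scheme \<Rightarrow> ('r, 'a, 'y) module_scheme \<Rightarrow> ('a \<Rightarrow> 'a \<Rightarrow> 'a)
      \<Rightarrow> ('a \<Rightarrow> 'a) set \<Rightarrow> ('a \<Rightarrow> 'a) set \<Rightarrow> ('a \<Rightarrow> 'a) set"
  where "poisson_bracket R A pb \<alpha> \<beta> =
    (let D = kaehler R A; d = kaehler_d R A in
      the_elem ((\<lambda>(f, g). \<Oplus>\<^bsub>D\<^esub>u\<in>support A f. \<Oplus>\<^bsub>D\<^esub>v\<in>support A g.
        (f u \<otimes>\<^bsub>A\<^esub> pb u (g v)) \<odot>\<^bsub>D\<^esub> d v \<oplus>\<^bsub>D\<^esub>
        (g v \<otimes>\<^bsub>A\<^esub> pb (f u) v) \<odot>\<^bsub>D\<^esub> d u \<oplus>\<^bsub>D\<^esub>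
        (f u \<otimes>\<^bsub>A\<^esub> g v) \<odot>\<^bsub>D\<^esub> d (pb u v)) ` (\<alpha> \<times> \<beta>)))"

text \<open>Injectivity of the adjoint \<open>D\<^sub>A \<rightarrow> Hom\<^sub>A(D\<^sub>A, A)\<close>.\<close>

definition nondegenerate ::
    "('r, 'x) ring_scheme \<Rightarrow> ('r, 'a, 'y) module_scheme \<Rightarrow> ('a \<Rightarrow> 'a \<Rightarrow> 'a) \<Rightarrow> bool"
  where "nondegenerate R A pb \<longleftrightarrow>
    inj_on (\<lambda>\<alpha>. restrict (poisson_form A pb \<alpha>) (carrier (kaehler R A))) (carrier (kaehler R A))"


section \<open>Lie-Rinehart structures and connections\<close>

text \<open>
  The structure maps of an \<open>(R, A)\<close>-Lie algebra: an \<open>A\<close>-module together with a bracket and an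
  action on \<open>A\<close>. Connections, curvature and flatness refer to these maps only.
\<close>

record ('a, 'l) lie_rinehart = "('a, 'l) module" +
  bracket :: "'l \<Rightarrow> 'l \<Rightarrow> 'l"
  act :: "'l \<Rightarrow> 'a \<Rightarrow> 'a"

definition poisson_lie ::
    "('r, 'x) ring_scheme \<Rightarrow> ('r, 'a, 'y) module_scheme \<Rightarrow> ('a \<Rightarrow> 'a \<Rightarrow> 'a)
      \<Rightarrow> ('a, ('a \<Rightarrow> 'a) set) lie_rinehart"
  where "poisson_lie R A pb =
    \<lparr>carrier = carrier (kaehler R A), mult = undefined, one = undefined,
     zero = \<zero>\<^bsub>kaehler R A\<^esub>, add = add (kaehler R A), smult = smult (kaehler R A),
     bracket = poisson_bracket R A pb, act = poisson_action A pb\<rparr>"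

text \<open>The extension of \<open>poisson_lie R A pb\<close> by the abelian ideal \<open>A\<close>, with cocycle minus the form.\<close>

definition poisson_lie_ext ::
    "('r, 'x) ring_scheme \<Rightarrow> ('r, 'a, 'y) module_scheme \<Rightarrow> ('a \<Rightarrow> 'a \<Rightarrow> 'a)
      \<Rightarrow> ('a, 'a \<times> ('a \<Rightarrow> 'a) set) lie_rinehart"
  where "poisson_lie_ext R A pb =
    (let D = poisson_lie R A pb in
      \<lparr>carrier = carrier A \<times> carrier D, mult = undefined, one = undefined,
       zero = (\<zero>\<^bsub>A\<^esub>, \<zero>\<^bsub>D\<^esub>),
       add = (\<lambda>(a, \<alpha>) (b, \<beta>). (a \<oplus>\<^bsub>A\<^esub> b, \<alpha> \<oplus>\<^bsub>D\<^esub> \<beta>)),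
       smult = (\<lambda>c (a, \<alpha>). (c \<otimes>\<^bsub>A\<^esub> a, c \<odot>\<^bsub>D\<^esub> \<alpha>)),
       bracket = (\<lambda>(a, \<alpha>) (b, \<beta>).
         ((act D \<alpha> b \<ominus>\<^bsub>A\<^esub> act D \<beta> a) \<ominus>\<^bsub>A\<^esub> poisson_form A pb \<alpha> \<beta>, bracket D \<alpha> \<beta>)),
       act = (\<lambda>(a, \<alpha>). act D \<alpha>)\<rparr>)"

definition poisson_iota ::
    "('r, 'x) ring_scheme \<Rightarrow> ('r, 'a, 'y) module_scheme \<Rightarrow> 'a \<Rightarrow> 'a \<times> ('a \<Rightarrow> 'a) set"
  where "poisson_iota R A a = (a, kaehler_d R A a)"

definition connection ::
    "('r, 'x) ring_scheme \<Rightarrow> ('r, 'a, 'y) module_scheme \<Rightarrow> ('a, 'l, 'z) lie_rinehart_scheme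
      \<Rightarrow> ('a, 'm, 'w) module_scheme \<Rightarrow> ('l \<Rightarrow> 'm \<Rightarrow> 'm) \<Rightarrow> bool"
  where "connection R A L M nab \<longleftrightarrow>
    (\<forall>\<alpha>\<in>carrier L. nab \<alpha> \<in> linear_maps R (restrict_scalars A M) (restrict_scalars A M)) \<and>
    (\<forall>\<alpha>\<in>carrier L. \<forall>\<beta>\<in>carrier L. \<forall>x\<in>carrier M. nab (\<alpha> \<oplus>\<^bsub>L\<^esub> \<beta>) x = nab \<alpha> x \<oplus>\<^bsub>M\<^esub> nab \<beta> x) \<and>
    (\<forall>r\<in>carrier R. \<forall>\<alpha>\<in>carrier L. \<forall>x\<in>carrier M.
      nab (r \<odot>\<^bsub>restrict_scalars A L\<^esub> \<alpha>) x = r \<odot>\<^bsub>restrict_scalars A M\<^esub> nab \<alpha> x) \<and>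
    (\<forall>a\<in>carrier A. \<forall>\<alpha>\<in>carrier L. \<forall>x\<in>carrier M. nab (a \<odot>\<^bsub>L\<^esub> \<alpha>) x = a \<odot>\<^bsub>M\<^esub> nab \<alpha> x) \<and>
    (\<forall>a\<in>carrier A. \<forall>\<alpha>\<in>carrier L. \<forall>x\<in>carrier M.
      nab \<alpha> (a \<odot>\<^bsub>M\<^esub> x) = (act L \<alpha> a \<odot>\<^bsub>M\<^esub> x) \<oplus>\<^bsub>M\<^esub> (a \<odot>\<^bsub>M\<^esub> nab \<alpha> x))"

definition curvature ::
    "('a, 'l, 'z) lie_rinehart_scheme \<Rightarrow> ('a, 'm, 'w) module_scheme \<Rightarrow> ('l \<Rightarrow> 'm \<Rightarrow> 'm)
      \<Rightarrow> 'l \<Rightarrow> 'l \<Rightarrow> 'm \<Rightarrow> 'm"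
  where "curvature L M nab \<alpha> \<beta> x =
    (nab \<alpha> (nab \<beta> x) \<ominus>\<^bsub>M\<^esub> nab \<beta> (nab \<alpha> x)) \<ominus>\<^bsub>M\<^esub> nab (bracket L \<alpha> \<beta>) x"

definition flat_connection ::
    "('r, 'x) ring_scheme \<Rightarrow> ('r, 'a, 'y) module_scheme \<Rightarrow> ('a, 'l, 'z) lie_rinehart_scheme
      \<Rightarrow> ('a, 'm, 'w) module_scheme \<Rightarrow> ('l \<Rightarrow> 'm \<Rightarrow> 'm) \<Rightarrow> bool"
  where "flat_connection R A L M nab \<longleftrightarrow> connection R A L M nab \<and>
    (\<forall>\<alpha>\<in>carrier L. \<forall>\<beta>\<in>carrier L. \<forall>x\<in>carrier M. curvature L M nab \<alpha> \<beta> x = \<zero>\<^bsub>M\<^esub>)"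

text \<open>
  For \<open>M\<close> projective of rank one, \<open>A \<rightarrow> End\<^sub>A(M)\<close>, sending \<open>a\<close> to multiplication by \<open>a\<close>, is an
  isomorphism; an \<open>A\<close>-valued form is the curvature when it is so under this identification.
\<close>

definition has_curvature ::
    "('a, 'l, 'z) lie_rinehart_scheme \<Rightarrow> ('a, 'm, 'w) module_scheme \<Rightarrow> ('l \<Rightarrow> 'm \<Rightarrow> 'm)
      \<Rightarrow> ('l \<Rightarrow> 'l \<Rightarrow> 'a) \<Rightarrow> bool"
  where "has_curvature L M nab \<omega> \<longleftrightarrow>
    (\<forall>\<alpha>\<in>carrier L. \<forall>\<beta>\<in>carrier L. \<forall>x\<in>carrier M. curvature L M nab \<alpha> \<beta> x = \<omega> \<alpha> \<beta> \<odot>\<^bsub>M\<^esub> x)"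

text \<open>
  A Poisson algebra is representable iff some pair \<open>(M, nab)\<close> satisfies the following predicate.
\<close>

definition representing_pair ::
    "('r, 'x) ring_scheme \<Rightarrow> ('r, 'a, 'y) module_scheme \<Rightarrow> ('a \<Rightarrow> 'a \<Rightarrow> 'a)
      \<Rightarrow> ('a, 'm, 'w) module_scheme \<Rightarrow> (('a \<Rightarrow> 'a) set \<Rightarrow> 'm \<Rightarrow> 'm) \<Rightarrow> bool"
  where "representing_pair R A pb M nab \<longleftrightarrow>
    projective_rank_one A M \<and> connection R A (poisson_lie R A pb) M nab \<and>
    has_curvature (poisson_lie R A pb) M nab (\<lambda>\<alpha> \<beta>. \<ominus>\<^bsub>A\<^esub> poisson_form A pb \<alpha> \<beta>)"

definition extended_connection ::
    "('a, 'm, 'w) module_scheme \<Rightarrow> ('l \<Rightarrow> 'm \<Rightarrow> 'm) \<Rightarrow> 'a \<times> 'l \<Rightarrow> 'm \<Rightarrow> 'm"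
  where "extended_connection M nab = (\<lambda>(a, \<alpha>) x. (a \<odot>\<^bsub>M\<^esub> x) \<oplus>\<^bsub>M\<^esub> nab \<alpha> x)"

end

theory Submission
  imports "HOL-Algebra.Ring_Divisibility" Defs
begin

text \<open>
Write \<open>E (a, \<alpha>)\<close> for the operator \<open>x \<mapsto> a x + \<nabla>\<^sub>\<alpha> x\<close>. Expanding \<open>E \<xi> (E \<eta> x)\<close> with the Leibniz rule of
\<open>\<nabla>\<close>, every cross term cancels in the commutator except the two derivatives \<open>\<alpha>(b)\<close>, \<open>\<beta>(a)\<close> and the
commutator of \<open>\<nabla>\<^sub>\<alpha>\<close> and \<open>\<nabla>\<^sub>\<beta>\<close>. The curvature \<open>-\<pi>\<close> of \<open>\<nabla>\<close> then contributes exactly the term \<open>-\<pi>(\<alpha>, \<beta>)\<close>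
that the cocycle puts into the bracket of the extension, so \<open>E\<close> is flat
(\<open>extended_connection_flat\<close>). Since \<open>da\<close> acts on \<open>b\<close> by \<open>{a, b}\<close>, since \<open>\<pi>(da, db) = {a, b}\<close> and
\<open>[da, db] = d{a, b}\<close>, the map \<open>\<iota> a = (a, da)\<close> respects the brackets:
\<open>{a, b} - {b, a} - {a, b} = {a, b}\<close> (\<open>iota_bracket\<close>). A flat connection composed with a Lie
morphism is a Lie representation. Scalars act by multiplication because \<open>d\<close> kills them.

For faithfulness let \<open>c\<close> act as zero. Then \<open>0 = \<rho> c (b x) = {c, b} x + b (\<rho> c x) = {c, b} x\<close> for all
\<open>b\<close> and \<open>x\<close>. A projective module of rank one has zero annihilator
(\<open>projective_rank_one_faithful\<close>), so \<open>c\<close> is a Casimir element; hence \<open>\<pi>(dc, -) = 0\<close>, and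
non-degeneracy gives \<open>dc = 0\<close>. Now \<open>c x = \<rho> c x = 0\<close> for all \<open>x\<close>, and \<open>c = 0\<close>
(\<open>rho_kernel_trivial\<close>).

Most of the work lies in showing that the form, the action and the bracket on Kaehler differentials
are well defined. Each of them is the additive or biadditive extension, to the free module on the
symbols \<open>du\<close>, of its formula on generators \<open>a du\<close>, and it has to vanish on the submodule \<open>N\<close> of
relations. For the action this is the universal property of the differentials. The form and the
bracket are alternating, so only the first argument needs attention; with second argument \<open>b dv\<close> fixed,
the form is \<open>b\<close> times the action on \<open>v\<close>, and the bracket is \<open>\<alpha>(b) dv + b L\<^sub>v \<alpha>\<close> for the Lie derivative
\<open>L\<^sub>v\<close>. The operator \<open>L\<^sub>v\<close> need not be \<open>A\<close>-linear, but it satisfies \<open>L\<^sub>v (a f) = {a, v} f + a L\<^sub>v f\<close> modulo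
relations, so the elements on which both the class and \<open>L\<^sub>v\<close> vanish form a submodule, which contains
the relations and therefore \<open>N\<close> (\<open>lie_kernel\<close>).
\<close>

section \<open>Free modules, quotient modules and generated submodules\<close>

lemma free_module_is_module:
  fixes A (structure)
  assumes "cring A"
  shows "module A (free_module A I)"
proof -
  interpret cring A by fact
  let ?F = "free_module A I"
  have grp: "abelian_group ?F"
  proof (rule abelian_groupI)
    fix f g assume fg: "f \<in> carrier ?F" "g \<in> carrier ?F"
    have "{i. f i \<oplus> g i \<noteq> \<zero>} \<subseteq> {i. f i \<noteq> \<zero>} \<union> {i. g i \<noteq> \<zero>}" by auto
    then have "finite {i. f i \<oplus> g i \<noteq> \<zero>}"
      using fg by (auto simp: free_module_def intro: finite_subset)
    with fg show "f \<oplus>\<^bsub>?F\<^esub> g \<in> carrier ?F" by (auto simp: free_module_def)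
  next
    fix f assume f: "f \<in> carrier ?F"
    then have fi: "f i \<in> carrier A" for i by (cases "i \<in> I") (auto simp: free_module_def)
    have "{i. \<ominus> f i \<noteq> \<zero>} \<subseteq> {i. f i \<noteq> \<zero>}" by auto
    then have "finite {i. \<ominus> f i \<noteq> \<zero>}"
      using f by (auto simp: free_module_def intro: finite_subset)
    with f have "(\<lambda>i. \<ominus> f i) \<in> carrier ?F" by (auto simp: free_module_def)
    moreover have "(\<lambda>i. \<ominus> f i) \<oplus>\<^bsub>?F\<^esub> f = \<zero>\<^bsub>?F\<^esub>"
      using fi by (auto simp: free_module_def l_neg)
    ultimately show "\<exists>g\<in>carrier ?F. g \<oplus>\<^bsub>?F\<^esub> f = \<zero>\<^bsub>?F\<^esub>" by blast
  next
    fix f g h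
    assume "f \<in> carrier ?F" "g \<in> carrier ?F" "h \<in> carrier ?F"
    then have "f i \<in> carrier A" "g i \<in> carrier A" "h i \<in> carrier A" for i
      by (cases "i \<in> I"; force simp: free_module_def)+
    then show "f \<oplus>\<^bsub>?F\<^esub> g \<oplus>\<^bsub>?F\<^esub> h = f \<oplus>\<^bsub>?F\<^esub> (g \<oplus>\<^bsub>?F\<^esub> h)"
      by (simp add: free_module_def a_assoc)
  next
    fix f g assume "f \<in> carrier ?F" "g \<in> carrier ?F"
    then have "f i \<in> carrier A" "g i \<in> carrier A" for i
      by (cases "i \<in> I"; force simp: free_module_def)+
    then show "f \<oplus>\<^bsub>?F\<^esub> g = g \<oplus>\<^bsub>?F\<^esub> f"
      by (simp add: free_module_def a_comm)
  next
    fix f assume "f \<in> carrier ?F"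
    then have "f i \<in> carrier A" for i
      by (cases "i \<in> I"; force simp: free_module_def)
    then show "\<zero>\<^bsub>?F\<^esub> \<oplus>\<^bsub>?F\<^esub> f = f" by (simp add: free_module_def)
  qed (auto simp: free_module_def)
  show ?thesis
  proof (rule moduleI[OF assms grp])
    fix a f assume af: "a \<in> carrier A" "f \<in> carrier ?F"
    have "{i. a \<otimes> f i \<noteq> \<zero>} \<subseteq> {i. f i \<noteq> \<zero>}" using af by auto
    then have "finite {i. a \<otimes> f i \<noteq> \<zero>}"
      using af by (auto simp: free_module_def intro: finite_subset)
    with af show "a \<odot>\<^bsub>?F\<^esub> f \<in> carrier ?F" by (auto simp: free_module_def)
  next
    fix a b f assume ab: "a \<in> carrier A" "b \<in> carrier A" and "f \<in> carrier ?F"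
    then have "f i \<in> carrier A" for i by (cases "i \<in> I"; force simp: free_module_def)
    with ab show "(a \<oplus> b) \<odot>\<^bsub>?F\<^esub> f = a \<odot>\<^bsub>?F\<^esub> f \<oplus>\<^bsub>?F\<^esub> b \<odot>\<^bsub>?F\<^esub> f"
      and "(a \<otimes> b) \<odot>\<^bsub>?F\<^esub> f = a \<odot>\<^bsub>?F\<^esub> (b \<odot>\<^bsub>?F\<^esub> f)"
      by (simp_all add: free_module_def l_distr m_assoc)
  next
    fix a f g assume a: "a \<in> carrier A" and "f \<in> carrier ?F" "g \<in> carrier ?F"
    then have "f i \<in> carrier A" "g i \<in> carrier A" for i
      by (cases "i \<in> I"; force simp: free_module_def)+
    with a show "a \<odot>\<^bsub>?F\<^esub> (f \<oplus>\<^bsub>?F\<^esub> g) = a \<odot>\<^bsub>?F\<^esub> f \<oplus>\<^bsub>?F\<^esub> a \<odot>\<^bsub>?F\<^esub> g"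
      by (simp add: free_module_def r_distr)
  next
    fix f assume "f \<in> carrier ?F"
    then have "f i \<in> carrier A" for i by (cases "i \<in> I"; force simp: free_module_def)
    then show "\<one> \<odot>\<^bsub>?F\<^esub> f = f" by (simp add: free_module_def)
  qed
qed

lemma (in module) submodule_abelian_subgroup:
  assumes "submodule N R M"
  shows "abelian_subgroup N M"
  by (rule abelian_subgroupI3[OF additive_subgroup.intro[OF submodule.axioms(1)[OF assms]]
        M.abelian_group_axioms])

lemma (in module) quotient_smult_coset:
  assumes "submodule N R M" "a \<in> carrier R" "x \<in> carrier M"
  shows "a \<odot>\<^bsub>quotient_module M N\<^esub> (N +>\<^bsub>M\<^esub> x) = N +>\<^bsub>M\<^esub> (a \<odot>\<^bsub>M\<^esub> x)"
proof -
  interpret N: abelian_subgroup N M by (rule submodule_abelian_subgroup[OF assms(1)])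
  have "N +>\<^bsub>M\<^esub> (a \<odot>\<^bsub>M\<^esub> y) = N +>\<^bsub>M\<^esub> (a \<odot>\<^bsub>M\<^esub> x)" if y: "y \<in> N +>\<^bsub>M\<^esub> x" for y
  proof -
    obtain n where n: "n \<in> N" "y = n \<oplus>\<^bsub>M\<^esub> x" using y by (auto simp: a_r_coset_def')
    have "a \<odot>\<^bsub>M\<^esub> n \<in> N" using submodule.smult_closed[OF assms(1,2) n(1)] .
    moreover have "a \<odot>\<^bsub>M\<^esub> y = a \<odot>\<^bsub>M\<^esub> n \<oplus>\<^bsub>M\<^esub> a \<odot>\<^bsub>M\<^esub> x"
      using n assms(2,3) by (simp add: smult_r_distr)
    ultimately have "a \<odot>\<^bsub>M\<^esub> y \<in> N +>\<^bsub>M\<^esub> (a \<odot>\<^bsub>M\<^esub> x)" by (auto simp: a_r_coset_def')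
    then show ?thesis
      using N.a_repr_independence'[OF _ smult_closed[OF assms(2,3)]] by simp
  qed
  moreover have "x \<in> N +>\<^bsub>M\<^esub> x" by (rule N.a_rcos_self[OF assms(3)])
  ultimately have "(\<Union>y\<in>N +>\<^bsub>M\<^esub> x. N +>\<^bsub>M\<^esub> (a \<odot>\<^bsub>M\<^esub> y)) = N +>\<^bsub>M\<^esub> (a \<odot>\<^bsub>M\<^esub> x)"
    by blast
  then show ?thesis by (simp add: quotient_module_def)
qed

lemma (in module) quotient_add_coset:
  assumes "submodule N R M" "x \<in> carrier M" "y \<in> carrier M"
  shows "(N +>\<^bsub>M\<^esub> x) \<oplus>\<^bsub>quotient_module M N\<^esub> (N +>\<^bsub>M\<^esub> y) = N +>\<^bsub>M\<^esub> (x \<oplus>\<^bsub>M\<^esub> y)"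
proof -
  interpret N: abelian_subgroup N M by (rule submodule_abelian_subgroup[OF assms(1)])
  show ?thesis using assms(2,3) by (simp add: quotient_module_def N.a_rcos_sum)
qed

lemma (in module) quotient_coset_cases:
  assumes "X \<in> carrier (quotient_module M N)"
  obtains x where "x \<in> carrier M" "X = N +>\<^bsub>M\<^esub> x"
  using assms by (auto simp: quotient_module_def A_RCOSETS_def')

lemma (in module) quotient_coset_closed:
  "x \<in> carrier M \<Longrightarrow> N +>\<^bsub>M\<^esub> x \<in> carrier (quotient_module M N)"
  by (auto simp: quotient_module_def A_RCOSETS_def')

lemma (in module) quotient_module_is_module:
  assumes N: "submodule N R M"
  shows "module R (quotient_module M N)"
proof -
  interpret N: abelian_subgroup N M by (rule submodule_abelian_subgroup[OF N])
  let ?Q = "quotient_module M N"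
  note ops = quotient_smult_coset[OF N] quotient_add_coset[OF N]
  have zero: "\<zero>\<^bsub>?Q\<^esub> = N +>\<^bsub>M\<^esub> \<zero>\<^bsub>M\<^esub>"
    using N.a_subset by (simp add: quotient_module_def)
  have grp: "abelian_group ?Q"
  proof (rule abelian_groupI)
    fix X Y assume "X \<in> carrier ?Q" "Y \<in> carrier ?Q"
    then show "X \<oplus>\<^bsub>?Q\<^esub> Y \<in> carrier ?Q" "X \<oplus>\<^bsub>?Q\<^esub> Y = Y \<oplus>\<^bsub>?Q\<^esub> X"
      by (auto elim!: quotient_coset_cases simp: ops M.a_comm intro!: quotient_coset_closed)
  next
    fix X Y Z assume "X \<in> carrier ?Q" "Y \<in> carrier ?Q" "Z \<in> carrier ?Q"
    then show "X \<oplus>\<^bsub>?Q\<^esub> Y \<oplus>\<^bsub>?Q\<^esub> Z = X \<oplus>\<^bsub>?Q\<^esub> (Y \<oplus>\<^bsub>?Q\<^esub> Z)"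
      by (auto elim!: quotient_coset_cases simp: ops M.a_assoc)
  next
    fix X assume "X \<in> carrier ?Q"
    then obtain x where x: "x \<in> carrier M" "X = N +>\<^bsub>M\<^esub> x" by (rule quotient_coset_cases)
    then show "\<zero>\<^bsub>?Q\<^esub> \<oplus>\<^bsub>?Q\<^esub> X = X" by (simp add: zero ops)
    have "(N +>\<^bsub>M\<^esub> (\<ominus>\<^bsub>M\<^esub> x)) \<oplus>\<^bsub>?Q\<^esub> X = \<zero>\<^bsub>?Q\<^esub>"
      using x by (simp add: ops zero M.l_neg)
    then show "\<exists>Y\<in>carrier ?Q. Y \<oplus>\<^bsub>?Q\<^esub> X = \<zero>\<^bsub>?Q\<^esub>"
      using x quotient_coset_closed M.a_inv_closed by blast
  qed (simp add: zero quotient_coset_closed)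
  show ?thesis
  proof (rule moduleI[OF R.cring_axioms grp])
    fix a X assume "a \<in> carrier R" "X \<in> carrier ?Q"
    then show "a \<odot>\<^bsub>?Q\<^esub> X \<in> carrier ?Q"
      by (auto elim!: quotient_coset_cases simp: ops intro!: quotient_coset_closed)
  next
    fix a b X assume "a \<in> carrier R" "b \<in> carrier R" "X \<in> carrier ?Q"
    then show "(a \<oplus>\<^bsub>R\<^esub> b) \<odot>\<^bsub>?Q\<^esub> X = a \<odot>\<^bsub>?Q\<^esub> X \<oplus>\<^bsub>?Q\<^esub> b \<odot>\<^bsub>?Q\<^esub> X"
      by (auto elim!: quotient_coset_cases simp: ops smult_l_distr)
  next
    fix a X Y assume "a \<in> carrier R" "X \<in> carrier ?Q" "Y \<in> carrier ?Q"
    then show "a \<odot>\<^bsub>?Q\<^esub> (X \<oplus>\<^bsub>?Q\<^esub> Y) = a \<odot>\<^bsub>?Q\<^esub> X \<oplus>\<^bsub>?Q\<^esub> a \<odot>\<^bsub>?Q\<^esub> Y"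
      by (auto elim!: quotient_coset_cases simp: ops smult_r_distr)
  next
    fix a b X assume "a \<in> carrier R" "b \<in> carrier R" "X \<in> carrier ?Q"
    then show "(a \<otimes>\<^bsub>R\<^esub> b) \<odot>\<^bsub>?Q\<^esub> X = a \<odot>\<^bsub>?Q\<^esub> (b \<odot>\<^bsub>?Q\<^esub> X)"
      by (auto elim!: quotient_coset_cases simp: ops smult_assoc1)
  next
    fix X assume "X \<in> carrier ?Q"
    then show "\<one>\<^bsub>R\<^esub> \<odot>\<^bsub>?Q\<^esub> X = X" by (auto elim!: quotient_coset_cases simp: ops)
  qed
qed

lemma (in module) generated_submodule_is_submodule:
  assumes "S \<subseteq> carrier M"
  shows "submodule (generated_submodule R M S) R M"
proof -
  have "carrier M \<in> {N. submodule N R M \<and> S \<subseteq> N}"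
    using assms carrier_is_submodule by simp
  moreover have "\<zero>\<^bsub>M\<^esub> \<in> N" if "submodule N R M" for N
    using subgroup.one_closed[OF submodule.axioms(1)[OF that]] by simp
  ultimately show ?thesis unfolding generated_submodule_def
    by (intro submoduleI Inter_greatest) (blast, auto intro: submoduleE(3-5))
qed

section \<open>Additive maps out of the free module on the ring\<close>

text \<open>
The element \<open>a du\<close> of the free module. These elements generate it as an additive group, which is what
makes additive maps, and not only linear ones, accessible by induction.
\<close>
abbreviation single :: "('a, 'x) ring_scheme \<Rightarrow> 'a \<Rightarrow> 'a \<Rightarrow> 'a \<Rightarrow> 'a"
  where "single A a u \<equiv> a \<odot>\<^bsub>free_module A (carrier A)\<^esub> basis_vector A u"

lemma (in cring) basis_vector_closed:
  "u \<in> carrier R \<Longrightarrow> basis_vector R u \<in> carrier (free_module R (carrier R))"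
  by (auto simp: free_module_def basis_vector_def)

lemma (in cring) single_eq:
  "a \<in> carrier R \<Longrightarrow> single R a u = (\<lambda>v. if v = u then a else \<zero>)"
  by (auto simp: free_module_def basis_vector_def)

lemma (in cring) single_closed:
  "a \<in> carrier R \<Longrightarrow> u \<in> carrier R \<Longrightarrow> single R a u \<in> carrier (free_module R (carrier R))"
  by (simp add: basis_vector_closed module.smult_closed[OF free_module_is_module] is_cring)

text \<open>
A finitely supported family is peeled off one coefficient at a time. All later identities between
additive or biadditive maps are reduced by this rule to their values on elements \<open>a du\<close>.
\<close>
lemma (in cring) free_module_induct [consumes 1, case_names single add]:
  assumes "f \<in> carrier (free_module R (carrier R))"
    and single: "\<And>a u. a \<in> carrier R \<Longrightarrow> u \<in> carrier R \<Longrightarrow> P (single R a u)"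
    and add: "\<And>f g. f \<in> carrier (free_module R (carrier R)) \<Longrightarrow> g \<in> carrier (free_module R (carrier R))
      \<Longrightarrow> P f \<Longrightarrow> P g \<Longrightarrow> P (f \<oplus>\<^bsub>free_module R (carrier R)\<^esub> g)"
  shows "P f"
proof -
  let ?F = "free_module R (carrier R)"
  have "\<forall>f\<in>carrier ?F. {u. f u \<noteq> \<zero>} \<subseteq> B \<longrightarrow> P f" if "finite B" for B
    using that
  proof (induction B)
    case empty
    have "P f" if "f \<in> carrier ?F" "{u. f u \<noteq> \<zero>} \<subseteq> {}" for f
    proof -
      have "f = single R \<zero> \<zero>" using that by (auto simp: single_eq)
      then show ?thesis using single by simp
    qed
    then show ?case by blast
  next
    case (insert u B)
    have "P f" if f: "f \<in> carrier ?F" "{v. f v \<noteq> \<zero>} \<subseteq> insert u B" for f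
    proof (cases "u \<in> carrier R")
      case True
      have fv: "f v \<in> carrier R" for v using f by (cases "v \<in> carrier R") (auto simp: free_module_def)
      let ?g = "f(u := \<zero>)"
      have "finite {v. ?g v \<noteq> \<zero>}"
        using insert.hyps f by (auto intro: finite_subset[of _ "insert u B"])
      then have g: "?g \<in> carrier ?F" using f by (auto simp: free_module_def)
      with f have "P ?g" if "{v. ?g v \<noteq> \<zero>} \<subseteq> B" using insert.IH that by blast
      moreover have "{v. ?g v \<noteq> \<zero>} \<subseteq> B" using f by auto
      ultimately have "P ?g" using insert.IH by blast
      moreover have "f = single R (f u) u \<oplus>\<^bsub>?F\<^esub> ?g"
        using fv by (auto simp: single_eq) (auto simp: free_module_def)
      ultimately show ?thesis using add[OF single_closed[OF fv True] g single[OF fv True]] by metis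
    next
      case False
      then have "f u = \<zero>" using f by (auto simp: free_module_def)
      then show ?thesis using insert.IH f by auto
    qed
    then show ?case by blast
  qed
  from this[of "{u. f u \<noteq> \<zero>}"] show ?thesis using assms(1) by (simp add: free_module_def)
qed

text \<open>
The additive map with \<open>a du \<mapsto> t a u\<close>. The maps \<open>t\<close> of interest are only additive in \<open>a\<close>: the bracket
differentiates coefficients, so a linear extension would not cover it.
\<close>
definition additive_extension ::
    "('a, 'x) ring_scheme \<Rightarrow> ('w, 'y) ring_scheme \<Rightarrow> ('a \<Rightarrow> 'a \<Rightarrow> 'w) \<Rightarrow> ('a \<Rightarrow> 'a) \<Rightarrow> 'w"
  where "additive_extension A W t f = (\<Oplus>\<^bsub>W\<^esub>u\<in>support A f. t (f u) u)"

locale additive_family = A: cring A + W: abelian_group W for A (structure) and W (structure) +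
  fixes t :: "'a \<Rightarrow> 'a \<Rightarrow> 'c"
  assumes closed: "a \<in> carrier A \<Longrightarrow> u \<in> carrier A \<Longrightarrow> t a u \<in> carrier W"
    and add: "a \<in> carrier A \<Longrightarrow> b \<in> carrier A \<Longrightarrow> u \<in> carrier A
      \<Longrightarrow> t (a \<oplus>\<^bsub>A\<^esub> b) u = t a u \<oplus>\<^bsub>W\<^esub> t b u"
begin

lemma t_zero: "u \<in> carrier A \<Longrightarrow> t \<zero>\<^bsub>A\<^esub> u = \<zero>\<^bsub>W\<^esub>"
  using add[of "\<zero>\<^bsub>A\<^esub>" "\<zero>\<^bsub>A\<^esub>" u] closed[of "\<zero>\<^bsub>A\<^esub>" u]
  by (simp add: W.add.l_cancel_one)

abbreviation (input) "FA \<equiv> free_module A (carrier A)"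

lemma coeff_closed: "f \<in> carrier FA \<Longrightarrow> f u \<in> carrier A"
  by (cases "u \<in> carrier A") (auto simp: free_module_def)

lemma finite_support: "f \<in> carrier FA \<Longrightarrow> finite (support A f)"
  by (auto simp: free_module_def support_def)

lemma extension_superset:
  assumes f: "f \<in> carrier FA" and B: "finite B" "support A f \<subseteq> B" "B \<subseteq> carrier A"
  shows "additive_extension A W t f = (\<Oplus>\<^bsub>W\<^esub>u\<in>B. t (f u) u)"
  unfolding additive_extension_def
proof (rule W.add.finprod_mono_neutral_cong_left[OF B(1,2)])
  show "t (f u) u = \<zero>\<^bsub>W\<^esub>" if "u \<in> B - support A f" for u
    using that B(3) t_zero by (auto simp: support_def)
  show "(\<lambda>u. t (f u) u) \<in> B \<rightarrow> carrier W" using B(3) closed coeff_closed[OF f] by auto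
qed simp

lemma extension_closed: "f \<in> carrier FA \<Longrightarrow> additive_extension A W t f \<in> carrier W"
  unfolding additive_extension_def
  by (rule W.finsum_closed) (auto simp: support_def coeff_closed closed)

lemma extension_add:
  assumes fg: "f \<in> carrier FA" "g \<in> carrier FA"
  shows "additive_extension A W t (f \<oplus>\<^bsub>FA\<^esub> g)
    = additive_extension A W t f \<oplus>\<^bsub>W\<^esub> additive_extension A W t g"
proof -
  interpret F: module A FA by (rule free_module_is_module) (rule A.is_cring)
  let ?B = "support A f \<union> support A g"
  have B: "finite ?B" "?B \<subseteq> carrier A" using fg finite_support by (auto simp: support_def)
  have B_carrier: "u \<in> carrier A" if "u \<in> ?B" for u using B(2) that by blast
  note coeffs = coeff_closed[OF fg(1)] coeff_closed[OF fg(2)]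
  have "support A (f \<oplus>\<^bsub>FA\<^esub> g) \<subseteq> ?B" by (auto simp: support_def free_module_def)
  then have "additive_extension A W t (f \<oplus>\<^bsub>FA\<^esub> g) = (\<Oplus>\<^bsub>W\<^esub>u\<in>?B. t (f u \<oplus>\<^bsub>A\<^esub> g u) u)"
    using extension_superset[OF F.a_closed[OF fg] B(1) _ B(2)] by (simp add: free_module_def)
  also have "\<dots> = (\<Oplus>\<^bsub>W\<^esub>u\<in>?B. t (f u) u \<oplus>\<^bsub>W\<^esub> t (g u) u)"
    by (rule W.finsum_cong') (simp_all add: B_carrier add coeffs closed Pi_def)
  also have "\<dots> = (\<Oplus>\<^bsub>W\<^esub>u\<in>?B. t (f u) u) \<oplus>\<^bsub>W\<^esub> (\<Oplus>\<^bsub>W\<^esub>u\<in>?B. t (g u) u)"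
    by (rule W.finsum_addf) (simp_all add: B_carrier coeffs closed Pi_def)
  also have "\<dots> = additive_extension A W t f \<oplus>\<^bsub>W\<^esub> additive_extension A W t g"
    by (simp only: extension_superset[OF fg(1) B(1) Un_upper1 B(2)]
        extension_superset[OF fg(2) B(1) Un_upper2 B(2)])
  finally show ?thesis .
qed

lemma extension_single:
  assumes "a \<in> carrier A" "u \<in> carrier A"
  shows "additive_extension A W t (single A a u) = t a u"
proof -
  have "support A (single A a u) \<subseteq> {u}" using assms by (auto simp: support_def A.single_eq)
  then have "additive_extension A W t (single A a u) = (\<Oplus>\<^bsub>W\<^esub>v\<in>{u}. t (single A a u v) v)"
    using assms A.single_closed by (intro extension_superset) auto
  also have "\<dots> = t a u" using assms by (simp add: A.single_eq closed)
  finally show ?thesis .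
qed

end

lemma abelian_group_hom_of_additive:
  assumes "abelian_group V" "abelian_group W"
    and "\<And>x. x \<in> carrier V \<Longrightarrow> h x \<in> carrier W"
    and "\<And>x y. x \<in> carrier V \<Longrightarrow> y \<in> carrier V \<Longrightarrow> h (x \<oplus>\<^bsub>V\<^esub> y) = h x \<oplus>\<^bsub>W\<^esub> h y"
  shows "abelian_group_hom V W h"
  using assms
  by (intro abelian_group_homI) (auto simp: group_hom_def group_hom_axioms_def hom_def
      intro: abelian_group.a_group)

lemma (in additive_family) extension_hom:
  "abelian_group_hom FA W (additive_extension A W t)"
proof -
  interpret F: module A FA by (rule free_module_is_module) (rule A.is_cring)
  show ?thesis
    by (rule abelian_group_hom_of_additive)
      (simp_all add: extension_closed extension_add F.abelian_group_axioms W.abelian_group_axioms)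
qed

locale biadditive_map = V: abelian_group V + W: abelian_group W for V and W +
  fixes X
  assumes closed: "f \<in> carrier V \<Longrightarrow> g \<in> carrier V \<Longrightarrow> X f g \<in> carrier W"
    and add_left: "f \<in> carrier V \<Longrightarrow> f' \<in> carrier V \<Longrightarrow> g \<in> carrier V
      \<Longrightarrow> X (f \<oplus>\<^bsub>V\<^esub> f') g = X f g \<oplus>\<^bsub>W\<^esub> X f' g"
    and add_right: "f \<in> carrier V \<Longrightarrow> g \<in> carrier V \<Longrightarrow> g' \<in> carrier V
      \<Longrightarrow> X f (g \<oplus>\<^bsub>V\<^esub> g') = X f g \<oplus>\<^bsub>W\<^esub> X f g'"
begin

lemma hom_left: "g \<in> carrier V \<Longrightarrow> abelian_group_hom V W (\<lambda>f. X f g)"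
  by (intro abelian_group_hom_of_additive closed add_left) unfold_locales

lemma hom_right: "f \<in> carrier V \<Longrightarrow> abelian_group_hom V W (X f)"
  by (intro abelian_group_hom_of_additive closed add_right) unfold_locales

lemma biadditive_minus_swap: "biadditive_map V W (\<lambda>f g. \<ominus>\<^bsub>W\<^esub> X g f)"
  by unfold_locales (simp_all add: closed add_left add_right W.minus_add)

end

text \<open>
Biadditive maps are determined by their values on pairs of generators; skew-symmetry of the form and
of the bracket is derived from this.
\<close>
lemma (in cring) biadditive_eqI:
  fixes W (structure) and X Y
  defines "F \<equiv> free_module R (carrier R)"
  assumes "biadditive_map F W X" "biadditive_map F W Y"
    and single: "\<And>a u b v. \<lbrakk>a \<in> carrier R; u \<in> carrier R; b \<in> carrier R; v \<in> carrier R\<rbrakk>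
      \<Longrightarrow> X (single R a u) (single R b v) = Y (single R a u) (single R b v)"
    and f: "f \<in> carrier F" and g: "g \<in> carrier F"
  shows "X f g = Y f g"
proof -
  interpret X: biadditive_map F W X by fact
  interpret Y: biadditive_map F W Y by fact
  note [simp] = X.add_left X.add_right Y.add_left Y.add_right single_closed[folded F_def]
  show ?thesis using f unfolding F_def
  proof (induction f rule: free_module_induct)
    case (single a u)
    show ?case using g unfolding F_def
    proof (induction g rule: free_module_induct)
      case (single b v)
      then show ?case using \<open>a \<in> carrier R\<close> \<open>u \<in> carrier R\<close> by (simp add: assms(4))
    next
      case (add g h)
      then show ?case using \<open>a \<in> carrier R\<close> \<open>u \<in> carrier R\<close> by (simp add: F_def[symmetric])
    qed
  next
    case (add f h)
    then show ?case using g by (simp add: F_def[symmetric])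
  qed
qed

definition biadditive_extension ::
    "('a, 'x) ring_scheme \<Rightarrow> ('w, 'y) ring_scheme \<Rightarrow> ('a \<Rightarrow> 'a \<Rightarrow> 'a \<Rightarrow> 'a \<Rightarrow> 'w)
      \<Rightarrow> ('a \<Rightarrow> 'a) \<Rightarrow> ('a \<Rightarrow> 'a) \<Rightarrow> 'w"
  where "biadditive_extension A W t f g =
    additive_extension A W (\<lambda>a u. additive_extension A W (t a u) g) f"

locale biadditive_family = A: cring A + W: abelian_group W for A and W +
  fixes t
  assumes closed: "\<lbrakk>a \<in> carrier A; u \<in> carrier A; b \<in> carrier A; v \<in> carrier A\<rbrakk>
      \<Longrightarrow> t a u b v \<in> carrier W"
    and add_left: "\<lbrakk>a \<in> carrier A; a' \<in> carrier A; u \<in> carrier A; b \<in> carrier A; v \<in> carrier A\<rbrakk>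
      \<Longrightarrow> t (a \<oplus>\<^bsub>A\<^esub> a') u b v = t a u b v \<oplus>\<^bsub>W\<^esub> t a' u b v"
    and add_right: "\<lbrakk>a \<in> carrier A; u \<in> carrier A; b \<in> carrier A; b' \<in> carrier A; v \<in> carrier A\<rbrakk>
      \<Longrightarrow> t a u (b \<oplus>\<^bsub>A\<^esub> b') v = t a u b v \<oplus>\<^bsub>W\<^esub> t a u b' v"
begin

abbreviation (input) "FA \<equiv> free_module A (carrier A)"

lemma inner_family:
  "a \<in> carrier A \<Longrightarrow> u \<in> carrier A \<Longrightarrow> additive_family A W (t a u)"
  by unfold_locales (simp_all add: closed add_right)

lemma outer_family:
  assumes g: "g \<in> carrier FA"
  shows "additive_family A W (\<lambda>a u. additive_extension A W (t a u) g)"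
proof unfold_locales
  fix a u assume "a \<in> carrier A" "u \<in> carrier A"
  then show "additive_extension A W (t a u) g \<in> carrier W"
    using additive_family.extension_closed[OF inner_family g] by blast
next
  fix a b u assume abu: "a \<in> carrier A" "b \<in> carrier A" "u \<in> carrier A"
  interpret a: additive_family A W "t a u" using abu by (simp add: inner_family)
  interpret b: additive_family A W "t b u" using abu by (simp add: inner_family)
  interpret ab: additive_family A W "t (a \<oplus>\<^bsub>A\<^esub> b) u" using abu by (simp add: inner_family)
  show "additive_extension A W (t (a \<oplus>\<^bsub>A\<^esub> b) u) g
      = additive_extension A W (t a u) g \<oplus>\<^bsub>W\<^esub> additive_extension A W (t b u) g"
    using g
  proof (induction g rule: A.free_module_induct)
    case (single c v)
    then show ?case using abu
      by (simp add: a.extension_single b.extension_single ab.extension_single add_left)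
  next
    case (add g h)
    then show ?case
      by (simp add: a.extension_add b.extension_add ab.extension_add
          a.extension_closed b.extension_closed W.a_ac)
  qed
qed

lemma extension_biadditive: "biadditive_map FA W (biadditive_extension A W t)"
proof -
  interpret F: module A FA by (rule free_module_is_module) (rule A.is_cring)
  show ?thesis
  proof unfold_locales
    fix f g assume "f \<in> carrier FA" "g \<in> carrier FA"
    then show "biadditive_extension A W t f g \<in> carrier W"
      unfolding biadditive_extension_def
      using additive_family.extension_closed[OF outer_family] by blast
  next
    fix f f' g assume "f \<in> carrier FA" "f' \<in> carrier FA" "g \<in> carrier FA"
    then show "biadditive_extension A W t (f \<oplus>\<^bsub>FA\<^esub> f') g
        = biadditive_extension A W t f g \<oplus>\<^bsub>W\<^esub> biadditive_extension A W t f' g"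
      unfolding biadditive_extension_def
      using additive_family.extension_add[OF outer_family] by blast
  next
    fix f g g' assume f: "f \<in> carrier FA" and g: "g \<in> carrier FA" "g' \<in> carrier FA"
    interpret g: additive_family A W "\<lambda>a u. additive_extension A W (t a u) g"
      using g by (simp add: outer_family)
    interpret g': additive_family A W "\<lambda>a u. additive_extension A W (t a u) g'"
      using g by (simp add: outer_family)
    interpret gg: additive_family A W "\<lambda>a u. additive_extension A W (t a u) (g \<oplus>\<^bsub>FA\<^esub> g')"
      using g by (simp add: outer_family)
    show "biadditive_extension A W t f (g \<oplus>\<^bsub>FA\<^esub> g')
        = biadditive_extension A W t f g \<oplus>\<^bsub>W\<^esub> biadditive_extension A W t f g'"
      unfolding biadditive_extension_def using f
    proof (induction f rule: A.free_module_induct)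
      case (single a u)
      then show ?case using g
        by (simp add: g.extension_single g'.extension_single gg.extension_single
            additive_family.extension_add[OF inner_family])
    next
      case (add f h)
      then show ?case
        by (simp add: g.extension_add g'.extension_add gg.extension_add
            g.extension_closed g'.extension_closed W.a_ac)
    qed
  qed
qed

lemma biextension_single:
  "\<lbrakk>a \<in> carrier A; u \<in> carrier A; b \<in> carrier A; v \<in> carrier A\<rbrakk>
    \<Longrightarrow> biadditive_extension A W t (single A a u) (single A b v) = t a u b v"
  by (simp add: biadditive_extension_def additive_family.extension_single[OF outer_family]
      additive_family.extension_single[OF inner_family] A.single_closed)

end

section \<open>Kaehler differentials\<close>

lemma the_elem_image_constant: "x \<in> X \<Longrightarrow> (\<And>y. y \<in> X \<Longrightarrow> h y = c) \<Longrightarrow> the_elem (h ` X) = c"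
  by (subgoal_tac "h ` X = {c}") auto

text \<open>
The scalar \<open>r\<close> is moved to the target through \<open>r 1\<close>, because \<open>W\<close> is only given as an \<open>A\<close>-module.
\<close>
definition derivation ::
    "('r, 'x) ring_scheme \<Rightarrow> ('r, 'a, 'y) module_scheme \<Rightarrow> ('a, 'w, 'z) module_scheme
      \<Rightarrow> ('a \<Rightarrow> 'w) \<Rightarrow> bool"
  where "derivation R A W \<theta> \<longleftrightarrow>
    (\<forall>u\<in>carrier A. \<theta> u \<in> carrier W) \<and>
    (\<forall>u\<in>carrier A. \<forall>v\<in>carrier A. \<theta> (u \<oplus>\<^bsub>A\<^esub> v) = \<theta> u \<oplus>\<^bsub>W\<^esub> \<theta> v) \<and>
    (\<forall>r\<in>carrier R. \<forall>u\<in>carrier A. \<theta> (r \<odot>\<^bsub>A\<^esub> u) = (r \<odot>\<^bsub>A\<^esub> \<one>\<^bsub>A\<^esub>) \<odot>\<^bsub>W\<^esub> \<theta> u) \<and>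
    (\<forall>u\<in>carrier A. \<forall>v\<in>carrier A. \<theta> (u \<otimes>\<^bsub>A\<^esub> v) = u \<odot>\<^bsub>W\<^esub> \<theta> v \<oplus>\<^bsub>W\<^esub> v \<odot>\<^bsub>W\<^esub> \<theta> u)"

locale kaehler_algebra = A: cring A + alg: algebra R A
  for R :: "('r, 'x) ring_scheme" and A :: "('r, 'a, 'y) module_scheme"
begin

abbreviation "F \<equiv> free_module A (carrier A)"
abbreviation "N \<equiv> kaehler_kernel R A"
abbreviation "D \<equiv> kaehler R A"
abbreviation "d \<equiv> kaehler_d R A"
abbreviation "\<delta> \<equiv> basis_vector A"
abbreviation "cls f \<equiv> N +>\<^bsub>F\<^esub> f"

sublocale F: module A F
  by (rule free_module_is_module) (rule A.is_cring)

lemma smult_conv_mult: "r \<in> carrier R \<Longrightarrow> u \<in> carrier A \<Longrightarrow> r \<odot>\<^bsub>A\<^esub> u = (r \<odot>\<^bsub>A\<^esub> \<one>\<^bsub>A\<^esub>) \<otimes>\<^bsub>A\<^esub> u"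
  by (simp add: alg.smult_assoc2)

lemma relations_subset: "kaehler_relations R A \<subseteq> carrier F"
  by (auto simp: kaehler_relations_def Let_def A.basis_vector_closed)

lemma kernel_submodule: "submodule N A F"
  unfolding kaehler_kernel_def
  by (rule F.generated_submodule_is_submodule[OF relations_subset])

lemma kernel_subset: "N \<subseteq> carrier F"
  by (rule F.submoduleE(1)[OF kernel_submodule])

sublocale D: module A D
  unfolding kaehler_def by (rule F.quotient_module_is_module[OF kernel_submodule])

sublocale N: abelian_subgroup N F
  by (rule F.submodule_abelian_subgroup[OF kernel_submodule])

lemma cls_closed: "f \<in> carrier F \<Longrightarrow> cls f \<in> carrier D"
  unfolding kaehler_def by (rule F.quotient_coset_closed)

lemma cls_add: "f \<in> carrier F \<Longrightarrow> g \<in> carrier F \<Longrightarrow> cls (f \<oplus>\<^bsub>F\<^esub> g) = cls f \<oplus>\<^bsub>D\<^esub> cls g"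
  unfolding kaehler_def by (simp add: F.quotient_add_coset[OF kernel_submodule])

lemma cls_smult: "a \<in> carrier A \<Longrightarrow> f \<in> carrier F \<Longrightarrow> cls (a \<odot>\<^bsub>F\<^esub> f) = a \<odot>\<^bsub>D\<^esub> cls f"
  unfolding kaehler_def by (simp add: F.quotient_smult_coset[OF kernel_submodule])

lemma cls_cases:
  assumes "\<alpha> \<in> carrier D"
  obtains f where "f \<in> carrier F" "\<alpha> = cls f"
  using assms unfolding kaehler_def by (rule F.quotient_coset_cases)

lemma kaehler_zero: "\<zero>\<^bsub>D\<^esub> = N"
  by (simp add: kaehler_def quotient_module_def)

lemma cls_kernel: "n \<in> N \<Longrightarrow> cls n = \<zero>\<^bsub>D\<^esub>"
  by (simp add: N.a_rcos_const kaehler_zero)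

sublocale cls: abelian_group_hom F D cls
  by (rule abelian_group_hom_of_additive)
    (simp_all add: cls_closed cls_add F.abelian_group_axioms D.abelian_group_axioms)

lemma d_conv: "d u = cls (\<delta> u)"
  by (simp add: kaehler_d_def)

lemma d_closed: "u \<in> carrier A \<Longrightarrow> d u \<in> carrier D"
  by (simp add: d_conv cls_closed A.basis_vector_closed)

lemma cls_single: "a \<in> carrier A \<Longrightarrow> u \<in> carrier A \<Longrightarrow> cls (single A a u) = a \<odot>\<^bsub>D\<^esub> d u"
  by (simp add: d_conv cls_smult A.basis_vector_closed)

lemma relation_cls_eq:
  assumes "x \<ominus>\<^bsub>F\<^esub> y \<in> kaehler_relations R A" "x \<in> carrier F" "y \<in> carrier F"
  shows "cls x = cls y"
proof -
  have "x \<ominus>\<^bsub>F\<^esub> y \<in> N"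
    using assms(1) by (auto simp: kaehler_kernel_def generated_submodule_def)
  then have "cls x \<ominus>\<^bsub>D\<^esub> cls y = \<zero>\<^bsub>D\<^esub>"
    using cls_kernel[of "x \<ominus>\<^bsub>F\<^esub> y"] assms(2,3) by (simp add: F.minus_eq D.minus_eq)
  moreover have "cls x = (cls x \<ominus>\<^bsub>D\<^esub> cls y) \<oplus>\<^bsub>D\<^esub> cls y"
    using assms(2,3) by (simp add: cls_closed D.minus_eq D.a_assoc D.l_neg)
  ultimately show ?thesis using assms(3) by (simp add: cls_closed)
qed

lemma relation_add: "u \<in> carrier A \<Longrightarrow> v \<in> carrier A
    \<Longrightarrow> \<delta> (u \<oplus>\<^bsub>A\<^esub> v) \<ominus>\<^bsub>F\<^esub> (\<delta> u \<oplus>\<^bsub>F\<^esub> \<delta> v) \<in> kaehler_relations R A"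
  and relation_smult: "r \<in> carrier R \<Longrightarrow> u \<in> carrier A
    \<Longrightarrow> \<delta> (r \<odot>\<^bsub>A\<^esub> u) \<ominus>\<^bsub>F\<^esub> ((r \<odot>\<^bsub>A\<^esub> \<one>\<^bsub>A\<^esub>) \<odot>\<^bsub>F\<^esub> \<delta> u) \<in> kaehler_relations R A"
  and relation_mult: "u \<in> carrier A \<Longrightarrow> v \<in> carrier A
    \<Longrightarrow> \<delta> (u \<otimes>\<^bsub>A\<^esub> v) \<ominus>\<^bsub>F\<^esub> ((u \<odot>\<^bsub>F\<^esub> \<delta> v) \<oplus>\<^bsub>F\<^esub> (v \<odot>\<^bsub>F\<^esub> \<delta> u)) \<in> kaehler_relations R A"
  unfolding kaehler_relations_def Let_def by blast+

lemma d_derivation: "derivation R A D d"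
  unfolding derivation_def
proof (intro conjI ballI)
  fix u v assume uv: "u \<in> carrier A" "v \<in> carrier A"
  note cl = A.basis_vector_closed[OF uv(1)] A.basis_vector_closed[OF uv(2)]
  show "d (u \<oplus>\<^bsub>A\<^esub> v) = d u \<oplus>\<^bsub>D\<^esub> d v"
    using relation_cls_eq[OF relation_add[OF uv]] uv cl
    by (simp add: d_conv cls_add A.basis_vector_closed)
  show "d (u \<otimes>\<^bsub>A\<^esub> v) = u \<odot>\<^bsub>D\<^esub> d v \<oplus>\<^bsub>D\<^esub> v \<odot>\<^bsub>D\<^esub> d u"
    using relation_cls_eq[OF relation_mult[OF uv]] uv cl
    by (simp add: d_conv cls_add cls_smult A.basis_vector_closed)
next
  fix r u assume ru: "r \<in> carrier R" "u \<in> carrier A"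
  then show "d (r \<odot>\<^bsub>A\<^esub> u) = (r \<odot>\<^bsub>A\<^esub> \<one>\<^bsub>A\<^esub>) \<odot>\<^bsub>D\<^esub> d u"
    using relation_cls_eq[OF relation_smult[OF ru]]
    by (simp add: d_conv cls_smult A.basis_vector_closed)
qed (simp add: d_closed)

text \<open>
To show that a map kills \<open>N\<close> it suffices to exhibit a submodule that it kills and that contains the
three kinds of relations. The submodule may be smaller than the kernel of the map, which need not be
a submodule itself.
\<close>
lemma kernel_subset_submodule:
  assumes K: "submodule K A F"
    and "\<And>u v. u \<in> carrier A \<Longrightarrow> v \<in> carrier A
      \<Longrightarrow> \<delta> (u \<oplus>\<^bsub>A\<^esub> v) \<ominus>\<^bsub>F\<^esub> (\<delta> u \<oplus>\<^bsub>F\<^esub> \<delta> v) \<in> K"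
    and "\<And>r u. r \<in> carrier R \<Longrightarrow> u \<in> carrier A
      \<Longrightarrow> \<delta> (r \<odot>\<^bsub>A\<^esub> u) \<ominus>\<^bsub>F\<^esub> ((r \<odot>\<^bsub>A\<^esub> \<one>\<^bsub>A\<^esub>) \<odot>\<^bsub>F\<^esub> \<delta> u) \<in> K"
    and "\<And>u v. u \<in> carrier A \<Longrightarrow> v \<in> carrier A
      \<Longrightarrow> \<delta> (u \<otimes>\<^bsub>A\<^esub> v) \<ominus>\<^bsub>F\<^esub> ((u \<odot>\<^bsub>F\<^esub> \<delta> v) \<oplus>\<^bsub>F\<^esub> (v \<odot>\<^bsub>F\<^esub> \<delta> u)) \<in> K"
  shows "N \<subseteq> K"
proof -
  have "kaehler_relations R A \<subseteq> K"
    unfolding kaehler_relations_def Let_def by (auto intro: assms(2-4))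
  then show ?thesis unfolding kaehler_kernel_def generated_submodule_def
    by (intro Inter_lower) (simp add: K)
qed

text \<open>
Evaluation on an arbitrary presentation of a differential gives the same value, so that an additive
map killing \<open>N\<close> descends to the differentials.
\<close>
lemma hom_constant_on_coset:
  assumes "abelian_group_hom F W E" and zero: "\<And>n. n \<in> N \<Longrightarrow> E n = \<zero>\<^bsub>W\<^esub>"
    and f: "f \<in> carrier F" and g: "g \<in> cls f"
  shows "g \<in> carrier F" and "E g = E f"
proof -
  interpret E: abelian_group_hom F W E by fact
  obtain n where n: "n \<in> N" "g = n \<oplus>\<^bsub>F\<^esub> f" using g by (auto simp: a_r_coset_def')
  then have nF: "n \<in> carrier F" using kernel_subset by blast
  with n f show "g \<in> carrier F" by simp
  show "E g = E f" using n f nF zero by simp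
qed

lemma self_in_cls: "f \<in> carrier F \<Longrightarrow> f \<in> cls f"
  by (rule N.a_rcos_self)

text \<open>
The universal property of Kaehler differentials: the linear map \<open>a du \<mapsto> a (\<theta> u)\<close> sends the three kinds
of relations to the three defining identities of a derivation.
\<close>
lemma derivation_extension:
  fixes W :: "('a, 'w, 'z) module_scheme"
  assumes "module A W" and der: "derivation R A W \<theta>"
  shows "additive_family A W (\<lambda>a u. a \<odot>\<^bsub>W\<^esub> \<theta> u)"
    and "n \<in> N \<Longrightarrow> additive_extension A W (\<lambda>a u. a \<odot>\<^bsub>W\<^esub> \<theta> u) n = \<zero>\<^bsub>W\<^esub>"
proof -
  interpret W: module A W by fact
  have th_closed: "\<theta> u \<in> carrier W" if "u \<in> carrier A" for u
    using der that unfolding derivation_def by blast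
  have th_add: "\<theta> (u \<oplus>\<^bsub>A\<^esub> v) = \<theta> u \<oplus>\<^bsub>W\<^esub> \<theta> v"
    and th_mult: "\<theta> (u \<otimes>\<^bsub>A\<^esub> v) = u \<odot>\<^bsub>W\<^esub> \<theta> v \<oplus>\<^bsub>W\<^esub> v \<odot>\<^bsub>W\<^esub> \<theta> u"
    if "u \<in> carrier A" "v \<in> carrier A" for u v
    using der that unfolding derivation_def by blast+
  have th_smult: "\<theta> (r \<odot>\<^bsub>A\<^esub> u) = (r \<odot>\<^bsub>A\<^esub> \<one>\<^bsub>A\<^esub>) \<odot>\<^bsub>W\<^esub> \<theta> u"
    if "r \<in> carrier R" "u \<in> carrier A" for r u
    using der that unfolding derivation_def by blast
  show fam: "additive_family A W (\<lambda>a u. a \<odot>\<^bsub>W\<^esub> \<theta> u)"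
    by unfold_locales (simp_all add: th_closed W.smult_l_distr)
  interpret t: additive_family A W "\<lambda>a u. a \<odot>\<^bsub>W\<^esub> \<theta> u" by (rule fam)
  let ?E = "additive_extension A W (\<lambda>a u. a \<odot>\<^bsub>W\<^esub> \<theta> u)"
  interpret E: abelian_group_hom F W ?E
    by (rule t.extension_hom)
  have lin: "?E (a \<odot>\<^bsub>F\<^esub> f) = a \<odot>\<^bsub>W\<^esub> ?E f" if a: "a \<in> carrier A" and f: "f \<in> carrier F" for a f
    using f
  proof (induction f rule: A.free_module_induct)
    case (single b u)
    have "a \<odot>\<^bsub>F\<^esub> single A b u = single A (a \<otimes>\<^bsub>A\<^esub> b) u"
      using a single by (simp add: F.smult_assoc1 A.basis_vector_closed)
    with single a show ?case by (simp add: t.extension_single W.smult_assoc1 th_closed)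
  next
    case (add f g)
    then show ?case using a by (simp add: F.smult_r_distr W.smult_r_distr)
  qed
  have E\<delta>: "?E (\<delta> u) = \<theta> u" if "u \<in> carrier A" for u
    using t.extension_single[of "\<one>\<^bsub>A\<^esub>" u] that by (simp add: A.basis_vector_closed th_closed)
  have eqI: "x \<ominus>\<^bsub>F\<^esub> y \<in> {f \<in> carrier F. ?E f = \<zero>\<^bsub>W\<^esub>}"
    if "x \<in> carrier F" "y \<in> carrier F" "?E x = ?E y" for x y
    using that by (simp add: F.minus_eq W.r_neg)
  note simps = E\<delta> lin A.basis_vector_closed th_add th_smult th_mult
  have "N \<subseteq> {f \<in> carrier F. ?E f = \<zero>\<^bsub>W\<^esub>}"
  proof (rule kernel_subset_submodule)
    show "submodule {f \<in> carrier F. ?E f = \<zero>\<^bsub>W\<^esub>} A F"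
      by (rule F.submoduleI) (auto simp: lin)
  qed (rule eqI; simp add: simps)+
  then show "n \<in> N \<Longrightarrow> ?E n = \<zero>\<^bsub>W\<^esub>" by blast
qed

lemma derivation_extension_cls:
  fixes W :: "('a, 'w, 'z) module_scheme"
  assumes W: "module A W" and der: "derivation R A W \<theta>" and f: "f \<in> carrier F"
  shows "the_elem ((\<lambda>f. additive_extension A W (\<lambda>a u. a \<odot>\<^bsub>W\<^esub> \<theta> u) f) ` cls f)
    = additive_extension A W (\<lambda>a u. a \<odot>\<^bsub>W\<^esub> \<theta> u) f"
proof -
  interpret W: module A W by fact
  interpret t: additive_family A W "\<lambda>a u. a \<odot>\<^bsub>W\<^esub> \<theta> u"
    by (rule derivation_extension(1)[OF W der])
  show ?thesis
    by (rule the_elem_image_constant[OF self_in_cls[OF f]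
          hom_constant_on_coset(2)[OF t.extension_hom derivation_extension(2)[OF W der] f]])
qed

text \<open>
By skew-symmetry, vanishing on \<open>N\<close> in the first argument gives vanishing in the second one.
\<close>
lemma alternating_descends:
  assumes "biadditive_map F W X"
    and skew: "\<And>f g. f \<in> carrier F \<Longrightarrow> g \<in> carrier F \<Longrightarrow> X f g = \<ominus>\<^bsub>W\<^esub> X g f"
    and zero: "\<And>n g. n \<in> N \<Longrightarrow> g \<in> carrier F \<Longrightarrow> X n g = \<zero>\<^bsub>W\<^esub>"
    and fg: "f \<in> carrier F" "g \<in> carrier F"
  shows "the_elem ((\<lambda>(f, g). X f g) ` (cls f \<times> cls g)) = X f g"
proof -
  interpret X: biadditive_map F W X by fact
  have "X f' g' = X f g" if f': "f' \<in> cls f" and g': "g' \<in> cls g" for f' g'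
  proof -
    have zero': "X f n = \<zero>\<^bsub>W\<^esub>" if "n \<in> N" for n
      using skew[OF fg(1), of n] zero[OF that fg(1)] that kernel_subset by auto
    have "g' \<in> carrier F" "X f g' = X f g"
      using hom_constant_on_coset[OF X.hom_right[OF fg(1)] zero' fg(2) g'] by simp_all
    moreover from this have "X f' g' = X f g'"
      using hom_constant_on_coset(2)[OF X.hom_left zero fg(1) f'] by blast
    ultimately show ?thesis by simp
  qed
  note const = this
  show ?thesis
  proof (rule the_elem_image_constant[of "(f, g)"])
    show "(f, g) \<in> cls f \<times> cls g" using fg by (simp add: self_in_cls)
    fix y assume "y \<in> cls f \<times> cls g"
    then obtain f' g' where "y = (f', g')" "f' \<in> cls f" "g' \<in> cls g" by blast
    then show "(case y of (f, g) \<Rightarrow> X f g) = X f g" by (simp only: prod.case const)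
  qed
qed

end

text \<open>
The ring \<open>A\<close> as the target of a derivation has to be \<open>regular_module A\<close>, since the scalar
multiplication of the algebra \<open>A\<close> itself is that of \<open>R\<close>.
\<close>
lemma regular_module_simps [simp]:
  "carrier (regular_module A) = carrier A" "\<zero>\<^bsub>regular_module A\<^esub> = \<zero>\<^bsub>A\<^esub>"
  "x \<oplus>\<^bsub>regular_module A\<^esub> y = x \<oplus>\<^bsub>A\<^esub> y" "x \<odot>\<^bsub>regular_module A\<^esub> y = x \<otimes>\<^bsub>A\<^esub> y"
  by (simp_all add: regular_module_def)

lemma additive_extension_regular [simp]:
  "additive_extension A (regular_module A) = additive_extension A A"
  by (intro ext) (simp add: additive_extension_def finsum_def finprod_def regular_module_def)

lemma (in cring) regular_module_is_module: "module R (regular_module R)"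
proof (rule moduleI[OF is_cring])
  show "abelian_group (regular_module R)"
    by (rule abelian_groupI) (auto simp: a_ac intro!: bexI[of _ "\<ominus> _"] l_neg)
qed (simp_all add: l_distr r_distr m_assoc)

section \<open>The Poisson structure on Kaehler differentials\<close>

locale poisson_kaehler = kaehler_algebra R A + P: poisson_algebra R A pb
  for R :: "('r, 'x) ring_scheme" and A :: "('r, 'a, 'y) module_scheme" and pb
begin

lemmas pb_closed [simp] = P.br_closed
lemmas pb_add_left = P.br_add_left
lemmas pb_add_right = P.br_add_right

lemma pb_skew:
  assumes "u \<in> carrier A" "v \<in> carrier A"
  shows "pb u v = \<ominus>\<^bsub>A\<^esub> pb v u"
proof -
  have "\<zero>\<^bsub>A\<^esub> = pb (u \<oplus>\<^bsub>A\<^esub> v) (u \<oplus>\<^bsub>A\<^esub> v)" using assms by (simp add: P.br_self)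
  also have "\<dots> = pb u v \<oplus>\<^bsub>A\<^esub> pb v u"
    using assms by (simp add: pb_add_left pb_add_right P.br_self[OF assms(1)] P.br_self[OF assms(2)] A.a_comm)
  finally have "pb u v \<oplus>\<^bsub>A\<^esub> pb v u = \<zero>\<^bsub>A\<^esub>" by simp
  then show ?thesis using assms by (simp add: A.minus_equality)
qed

lemma pb_mult_left:
  "\<lbrakk>a \<in> carrier A; b \<in> carrier A; c \<in> carrier A\<rbrakk>
    \<Longrightarrow> pb (a \<otimes>\<^bsub>A\<^esub> b) c = a \<otimes>\<^bsub>A\<^esub> pb b c \<oplus>\<^bsub>A\<^esub> b \<otimes>\<^bsub>A\<^esub> pb a c"
  by (simp add: P.leibniz A.m_comm)

lemma pb_one: "c \<in> carrier A \<Longrightarrow> pb \<one>\<^bsub>A\<^esub> c = \<zero>\<^bsub>A\<^esub>"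
  using pb_mult_left[of "\<one>\<^bsub>A\<^esub>" "\<one>\<^bsub>A\<^esub>" c] by (simp add: A.add.l_cancel_one)

lemma pb_zero: "c \<in> carrier A \<Longrightarrow> pb \<zero>\<^bsub>A\<^esub> c = \<zero>\<^bsub>A\<^esub>"
  using pb_add_left[of "\<zero>\<^bsub>A\<^esub>" "\<zero>\<^bsub>A\<^esub>" c] by (simp add: A.add.l_cancel_one)

lemma pb_smult: "\<lbrakk>r \<in> carrier R; u \<in> carrier A; v \<in> carrier A\<rbrakk>
    \<Longrightarrow> pb (r \<odot>\<^bsub>A\<^esub> u) v = (r \<odot>\<^bsub>A\<^esub> \<one>\<^bsub>A\<^esub>) \<otimes>\<^bsub>A\<^esub> pb u v"
  by (simp add: P.br_smult_left flip: smult_conv_mult)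

lemma pb_scalar: "r \<in> carrier R \<Longrightarrow> c \<in> carrier A \<Longrightarrow> pb (r \<odot>\<^bsub>A\<^esub> \<one>\<^bsub>A\<^esub>) c = \<zero>\<^bsub>A\<^esub>"
  by (simp add: P.br_smult_left pb_one)

lemma d_add: "u \<in> carrier A \<Longrightarrow> v \<in> carrier A \<Longrightarrow> d (u \<oplus>\<^bsub>A\<^esub> v) = d u \<oplus>\<^bsub>D\<^esub> d v"
  and d_smult: "r \<in> carrier R \<Longrightarrow> u \<in> carrier A \<Longrightarrow> d (r \<odot>\<^bsub>A\<^esub> u) = (r \<odot>\<^bsub>A\<^esub> \<one>\<^bsub>A\<^esub>) \<odot>\<^bsub>D\<^esub> d u"
  and d_mult: "u \<in> carrier A \<Longrightarrow> v \<in> carrier A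
    \<Longrightarrow> d (u \<otimes>\<^bsub>A\<^esub> v) = u \<odot>\<^bsub>D\<^esub> d v \<oplus>\<^bsub>D\<^esub> v \<odot>\<^bsub>D\<^esub> d u"
  using d_derivation unfolding derivation_def by blast+

lemma d_zero: "d \<zero>\<^bsub>A\<^esub> = \<zero>\<^bsub>D\<^esub>"
  using d_add[of "\<zero>\<^bsub>A\<^esub>" "\<zero>\<^bsub>A\<^esub>"] d_closed[of "\<zero>\<^bsub>A\<^esub>"] by (simp add: D.add.l_cancel_one)

lemma d_minus: "u \<in> carrier A \<Longrightarrow> d (\<ominus>\<^bsub>A\<^esub> u) = \<ominus>\<^bsub>D\<^esub> d u"
  using d_add[of "\<ominus>\<^bsub>A\<^esub> u" u] by (simp add: A.l_neg d_zero D.minus_equality d_closed)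

lemma d_scalar: "r \<in> carrier R \<Longrightarrow> d (r \<odot>\<^bsub>A\<^esub> \<one>\<^bsub>A\<^esub>) = \<zero>\<^bsub>D\<^esub>"
proof -
  have "d \<one>\<^bsub>A\<^esub> = \<zero>\<^bsub>D\<^esub>"
    using d_mult[of "\<one>\<^bsub>A\<^esub>" "\<one>\<^bsub>A\<^esub>"] d_closed[of "\<one>\<^bsub>A\<^esub>"] by (simp add: D.add.l_cancel_one)
  then show "r \<in> carrier R \<Longrightarrow> d (r \<odot>\<^bsub>A\<^esub> \<one>\<^bsub>A\<^esub>) = \<zero>\<^bsub>D\<^esub>" by (simp add: d_smult)
qed

subsection \<open>The action\<close>

lemma pb_derivation: "c \<in> carrier A \<Longrightarrow> derivation R A (regular_module A) (\<lambda>u. pb u c)"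
  by (simp add: derivation_def pb_add_left pb_smult pb_mult_left)

abbreviation "action_ext c \<equiv> additive_extension A A (\<lambda>a u. a \<otimes>\<^bsub>A\<^esub> pb u c)"

lemma action_family: "c \<in> carrier A \<Longrightarrow> additive_family A A (\<lambda>a u. a \<otimes>\<^bsub>A\<^esub> pb u c)"
  by unfold_locales (simp_all add: A.l_distr)

lemmas action_ext_closed = additive_family.extension_closed[OF action_family]
lemmas action_ext_add = additive_family.extension_add[OF action_family]
lemmas action_ext_single = additive_family.extension_single[OF action_family]

lemma action_ext_kernel: "c \<in> carrier A \<Longrightarrow> n \<in> N \<Longrightarrow> action_ext c n = \<zero>\<^bsub>A\<^esub>"
  using derivation_extension(2)[OF A.regular_module_is_module pb_derivation] by simp

lemma action_cls: "c \<in> carrier A \<Longrightarrow> f \<in> carrier F \<Longrightarrow> poisson_action A pb (cls f) c = action_ext c f"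
  unfolding poisson_action_def additive_extension_def
  by (rule derivation_extension_cls[OF A.regular_module_is_module pb_derivation,
        unfolded additive_extension_regular regular_module_simps additive_extension_def])

lemma action_closed: "\<alpha> \<in> carrier D \<Longrightarrow> c \<in> carrier A \<Longrightarrow> poisson_action A pb \<alpha> c \<in> carrier A"
  by (erule cls_cases) (simp add: action_cls action_ext_closed)

lemma action_d: "a \<in> carrier A \<Longrightarrow> c \<in> carrier A \<Longrightarrow> poisson_action A pb (d a) c = pb a c"
  using action_ext_single[of c "\<one>\<^bsub>A\<^esub>" a]
  by (simp add: d_conv action_cls A.basis_vector_closed)

subsection \<open>The form\<close>

abbreviation "form_ext \<equiv> biadditive_extension A A (\<lambda>a u b v. (a \<otimes>\<^bsub>A\<^esub> b) \<otimes>\<^bsub>A\<^esub> pb u v)"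

lemma form_family: "biadditive_family A A (\<lambda>a u b v. (a \<otimes>\<^bsub>A\<^esub> b) \<otimes>\<^bsub>A\<^esub> pb u v)"
  by unfold_locales (simp_all add: A.l_distr A.r_distr)

sublocale form: biadditive_map F A form_ext
  by (rule biadditive_family.extension_biadditive[OF form_family])

lemmas form_ext_single = biadditive_family.biextension_single[OF form_family]

text \<open>
With \<open>b dv\<close> in the second place the form is a multiple of the action on \<open>v\<close>, which is already known to
be well defined.
\<close>
lemma form_ext_single_right:
  assumes f: "f \<in> carrier F" and b: "b \<in> carrier A" "v \<in> carrier A"
  shows "form_ext f (single A b v) = b \<otimes>\<^bsub>A\<^esub> action_ext v f"
  using f
proof (induction f rule: A.free_module_induct)
  case (single a u)
  then show ?case using b by (simp add: form_ext_single action_ext_single A.m_ac)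
next
  case (add f g)
  then show ?case using b
    by (simp add: form.add_left A.single_closed action_ext_add action_ext_closed A.r_distr)
qed

lemma form_ext_kernel:
  assumes n: "n \<in> N" and g: "g \<in> carrier F"
  shows "form_ext n g = \<zero>\<^bsub>A\<^esub>"
proof -
  have nF: "n \<in> carrier F" using n kernel_subset by blast
  show ?thesis using g
  proof (induction g rule: A.free_module_induct)
    case (single b v)
    then show ?case using n nF by (simp add: form_ext_single_right action_ext_kernel)
  next
    case (add f g)
    then show ?case using nF by (simp add: form.add_right)
  qed
qed

lemma form_ext_skew:
  assumes "f \<in> carrier F" "g \<in> carrier F"
  shows "form_ext f g = \<ominus>\<^bsub>A\<^esub> form_ext g f"
proof (rule A.biadditive_eqI[where f = f and g = g])
  fix a u b v assume "a \<in> carrier A" "u \<in> carrier A" "b \<in> carrier A" "v \<in> carrier A"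
  then show "form_ext (single A a u) (single A b v)
      = \<ominus>\<^bsub>A\<^esub> form_ext (single A b v) (single A a u)"
    using pb_skew[of u v] by (simp add: form_ext_single A.r_minus A.m_comm)
qed (use assms form.biadditive_minus_swap form.biadditive_map_axioms in simp_all)

lemma form_cls: "f \<in> carrier F \<Longrightarrow> g \<in> carrier F \<Longrightarrow> poisson_form A pb (cls f) (cls g) = form_ext f g"
  using alternating_descends[OF form.biadditive_map_axioms form_ext_skew form_ext_kernel]
  by (simp add: poisson_form_def biadditive_extension_def[abs_def] additive_extension_def[abs_def])

lemma form_closed: "\<alpha> \<in> carrier D \<Longrightarrow> \<beta> \<in> carrier D \<Longrightarrow> poisson_form A pb \<alpha> \<beta> \<in> carrier A"
  by (elim cls_cases) (simp add: form_cls form.closed)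

lemma form_d: "a \<in> carrier A \<Longrightarrow> b \<in> carrier A \<Longrightarrow> poisson_form A pb (d a) (d b) = pb a b"
  using form_ext_single[of "\<one>\<^bsub>A\<^esub>" a "\<one>\<^bsub>A\<^esub>" b]
  by (simp add: d_conv form_cls A.basis_vector_closed)

text \<open>
An element of the Poisson centre has its differential in the radical of the form, since the form is
determined by its values on generators.
\<close>
lemma form_d_casimir:
  assumes c: "c \<in> carrier A" and casimir: "\<And>b. b \<in> carrier A \<Longrightarrow> pb c b = \<zero>\<^bsub>A\<^esub>"
    and \<beta>: "\<beta> \<in> carrier D"
  shows "poisson_form A pb (d c) \<beta> = \<zero>\<^bsub>A\<^esub>"
proof -
  obtain g where g: "g \<in> carrier F" "\<beta> = cls g" using \<beta> by (rule cls_cases)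
  have "form_ext (\<delta> c) g = \<zero>\<^bsub>A\<^esub>" using g(1)
  proof (induction g rule: A.free_module_induct)
    case (single b v)
    then show ?case using c casimir form_ext_single[of "\<one>\<^bsub>A\<^esub>" c b v]
      by (simp add: A.basis_vector_closed)
  next
    case (add f g)
    then show ?case using c by (simp add: form.add_right A.basis_vector_closed)
  qed
  then show ?thesis using g c by (simp add: d_conv form_cls A.basis_vector_closed)
qed

subsection \<open>The bracket\<close>

text \<open>
Up to sign, the Lie derivative along the Hamiltonian vector field of \<open>v\<close>; that is,
\<open>a du \<mapsto> [a du, dv]\<close>.
\<close>
abbreviation "lie_derivative v \<equiv>
  additive_extension A D (\<lambda>a u. pb a v \<odot>\<^bsub>D\<^esub> d u \<oplus>\<^bsub>D\<^esub> a \<odot>\<^bsub>D\<^esub> d (pb u v))"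

lemma lie_family:
  "v \<in> carrier A \<Longrightarrow> additive_family A D (\<lambda>a u. pb a v \<odot>\<^bsub>D\<^esub> d u \<oplus>\<^bsub>D\<^esub> a \<odot>\<^bsub>D\<^esub> d (pb u v))"
  by unfold_locales (simp_all add: d_closed pb_add_left D.smult_l_distr D.a_ac)

lemmas lie_closed = additive_family.extension_closed[OF lie_family]
lemmas lie_add = additive_family.extension_add[OF lie_family]
lemmas lie_single = additive_family.extension_single[OF lie_family]

text \<open>
The failure of \<open>A\<close>-linearity is a multiple of the class of \<open>f\<close>, so it disappears on \<open>N\<close>.
\<close>
lemma lie_smult:
  assumes f: "f \<in> carrier F" and a: "a \<in> carrier A" and v: "v \<in> carrier A"
  shows "lie_derivative v (a \<odot>\<^bsub>F\<^esub> f) = pb a v \<odot>\<^bsub>D\<^esub> cls f \<oplus>\<^bsub>D\<^esub> a \<odot>\<^bsub>D\<^esub> lie_derivative v f"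
  using f
proof (induction f rule: A.free_module_induct)
  case (single b u)
  have "a \<odot>\<^bsub>F\<^esub> single A b u = single A (a \<otimes>\<^bsub>A\<^esub> b) u"
    using a single by (simp add: F.smult_assoc1 A.basis_vector_closed)
  then have "lie_derivative v (a \<odot>\<^bsub>F\<^esub> single A b u)
      = pb (a \<otimes>\<^bsub>A\<^esub> b) v \<odot>\<^bsub>D\<^esub> d u \<oplus>\<^bsub>D\<^esub> (a \<otimes>\<^bsub>A\<^esub> b) \<odot>\<^bsub>D\<^esub> d (pb u v)"
    using single a v by (simp add: lie_single)
  also have "\<dots> = pb a v \<odot>\<^bsub>D\<^esub> cls (single A b u) \<oplus>\<^bsub>D\<^esub> a \<odot>\<^bsub>D\<^esub> lie_derivative v (single A b u)"
    using single a v
    by (simp add: lie_single cls_single pb_mult_left d_closed D.smult_l_distr D.smult_r_distr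
        A.m_comm[of "pb a v" b] D.a_ac flip: D.smult_assoc1)
  finally show ?case .
next
  case (add f g)
  then show ?case using a v
    by (simp add: F.smult_r_distr D.smult_r_distr lie_add lie_closed cls_closed D.a_ac)
qed

text \<open>
The kernel of the Lie derivative need not be a submodule, but its intersection with the elements of class
zero is one by \<open>lie_smult\<close>. The relations lie in it because \<open>d\<close> and the bracket with \<open>v\<close> are
derivations.
\<close>
lemma lie_kernel:
  assumes v: "v \<in> carrier A" and n: "n \<in> N"
  shows "lie_derivative v n = \<zero>\<^bsub>D\<^esub>"
proof -
  let ?K = "{f \<in> carrier F. cls f = \<zero>\<^bsub>D\<^esub> \<and> lie_derivative v f = \<zero>\<^bsub>D\<^esub>}"
  interpret L: abelian_group_hom F D "lie_derivative v"
    by (rule additive_family.extension_hom[OF lie_family[OF v]])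
  have eqI: "x \<ominus>\<^bsub>F\<^esub> y \<in> ?K"
    if "x \<in> carrier F" "y \<in> carrier F" "cls x = cls y" "lie_derivative v x = lie_derivative v y" for x y
    using that by (simp add: F.minus_eq D.r_neg)
  have L\<delta>: "lie_derivative v (\<delta> u) = d (pb u v)" if "u \<in> carrier A" for u
    using lie_single[of v "\<one>\<^bsub>A\<^esub>" u] that v
    by (simp add: A.basis_vector_closed d_closed pb_one)
  note simps = A.basis_vector_closed cls_closed cls_smult d_conv[symmetric] L\<delta> lie_smult
    d_closed d_add d_mult d_smult pb_scalar
  have "N \<subseteq> ?K"
  proof (rule kernel_subset_submodule)
    show "submodule ?K A F"
      by (rule F.submoduleI) (auto simp: lie_smult v cls_smult)
  next
    fix u w assume "u \<in> carrier A" "w \<in> carrier A"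
    then show "\<delta> (u \<oplus>\<^bsub>A\<^esub> w) \<ominus>\<^bsub>F\<^esub> (\<delta> u \<oplus>\<^bsub>F\<^esub> \<delta> w) \<in> ?K"
      by (intro eqI) (simp_all add: simps v pb_add_left)
  next
    fix r u assume "r \<in> carrier R" "u \<in> carrier A"
    then show "\<delta> (r \<odot>\<^bsub>A\<^esub> u) \<ominus>\<^bsub>F\<^esub> ((r \<odot>\<^bsub>A\<^esub> \<one>\<^bsub>A\<^esub>) \<odot>\<^bsub>F\<^esub> \<delta> u) \<in> ?K"
      by (intro eqI) (simp_all add: simps v P.br_smult_left pb_one)
  next
    fix u w assume uw: "u \<in> carrier A" "w \<in> carrier A"
    then show "\<delta> (u \<otimes>\<^bsub>A\<^esub> w) \<ominus>\<^bsub>F\<^esub> ((u \<odot>\<^bsub>F\<^esub> \<delta> w) \<oplus>\<^bsub>F\<^esub> (w \<odot>\<^bsub>F\<^esub> \<delta> u)) \<in> ?K"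
      by (intro eqI) (simp_all add: simps v pb_mult_left D.a_ac)
  qed
  with n show ?thesis by blast
qed

abbreviation "bracket_ext \<equiv> biadditive_extension A D (\<lambda>a u b v.
  (a \<otimes>\<^bsub>A\<^esub> pb u b) \<odot>\<^bsub>D\<^esub> d v \<oplus>\<^bsub>D\<^esub> (b \<otimes>\<^bsub>A\<^esub> pb a v) \<odot>\<^bsub>D\<^esub> d u \<oplus>\<^bsub>D\<^esub> (a \<otimes>\<^bsub>A\<^esub> b) \<odot>\<^bsub>D\<^esub> d (pb u v))"

lemma bracket_family: "biadditive_family A D (\<lambda>a u b v.
  (a \<otimes>\<^bsub>A\<^esub> pb u b) \<odot>\<^bsub>D\<^esub> d v \<oplus>\<^bsub>D\<^esub> (b \<otimes>\<^bsub>A\<^esub> pb a v) \<odot>\<^bsub>D\<^esub> d u \<oplus>\<^bsub>D\<^esub> (a \<otimes>\<^bsub>A\<^esub> b) \<odot>\<^bsub>D\<^esub> d (pb u v))"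
  by unfold_locales (simp_all add: d_closed pb_add_left pb_add_right A.l_distr A.r_distr
      D.smult_l_distr D.a_ac)

sublocale bracket: biadditive_map F D bracket_ext
  by (rule biadditive_family.extension_biadditive[OF bracket_family])

lemmas bracket_ext_single = biadditive_family.biextension_single[OF bracket_family]

text \<open>
The formula \<open>[\<alpha>, b dv] = \<alpha>(b) dv + b [\<alpha>, dv]\<close>, which reduces the well-definedness of the bracket to that
of the action and of the Lie derivative.
\<close>
lemma bracket_ext_single_right:
  assumes f: "f \<in> carrier F" and b: "b \<in> carrier A" "v \<in> carrier A"
  shows "bracket_ext f (single A b v)
    = action_ext b f \<odot>\<^bsub>D\<^esub> d v \<oplus>\<^bsub>D\<^esub> b \<odot>\<^bsub>D\<^esub> lie_derivative v f"
  using f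
proof (induction f rule: A.free_module_induct)
  case (single a u)
  then show ?case using b
    by (simp add: bracket_ext_single action_ext_single lie_single d_closed D.smult_r_distr
        A.m_comm[of b a] D.a_assoc flip: D.smult_assoc1)
next
  case (add f g)
  then show ?case using b
    by (simp add: bracket.add_left A.single_closed action_ext_add action_ext_closed
        lie_add lie_closed d_closed D.smult_l_distr D.smult_r_distr D.a_ac)
qed

lemma bracket_ext_kernel:
  assumes n: "n \<in> N" and g: "g \<in> carrier F"
  shows "bracket_ext n g = \<zero>\<^bsub>D\<^esub>"
proof -
  have nF: "n \<in> carrier F" using n kernel_subset by blast
  show ?thesis using g
  proof (induction g rule: A.free_module_induct)
    case (single b v)
    then show ?case using n nF
      by (simp add: bracket_ext_single_right action_ext_kernel lie_kernel d_closed)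
  next
    case (add f g)
    then show ?case using nF by (simp add: bracket.add_right)
  qed
qed

lemma bracket_ext_skew:
  assumes "f \<in> carrier F" "g \<in> carrier F"
  shows "bracket_ext f g = \<ominus>\<^bsub>D\<^esub> bracket_ext g f"
proof (rule A.biadditive_eqI[where f = f and g = g])
  fix a u b v assume ab: "a \<in> carrier A" "u \<in> carrier A" "b \<in> carrier A" "v \<in> carrier A"
  then show "bracket_ext (single A a u) (single A b v)
      = \<ominus>\<^bsub>D\<^esub> bracket_ext (single A b v) (single A a u)"
    using pb_skew[of b u] pb_skew[of v a] pb_skew[of v u]
    by (simp add: bracket_ext_single d_closed d_minus A.r_minus A.m_comm[of b a]
        D.smult_l_minus D.smult_r_minus D.minus_add D.a_ac)
qed (use assms bracket.biadditive_minus_swap bracket.biadditive_map_axioms in simp_all)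

lemma bracket_cls:
  "f \<in> carrier F \<Longrightarrow> g \<in> carrier F \<Longrightarrow> poisson_bracket R A pb (cls f) (cls g) = bracket_ext f g"
  using alternating_descends[OF bracket.biadditive_map_axioms bracket_ext_skew bracket_ext_kernel]
  by (simp add: poisson_bracket_def Let_def biadditive_extension_def[abs_def]
      additive_extension_def[abs_def])

lemma bracket_closed:
  "\<alpha> \<in> carrier D \<Longrightarrow> \<beta> \<in> carrier D \<Longrightarrow> poisson_bracket R A pb \<alpha> \<beta> \<in> carrier D"
  by (elim cls_cases) (simp add: bracket_cls bracket.closed)

lemma bracket_d:
  "a \<in> carrier A \<Longrightarrow> b \<in> carrier A \<Longrightarrow> poisson_bracket R A pb (d a) (d b) = d (pb a b)"
  using bracket_ext_single[of "\<one>\<^bsub>A\<^esub>" a "\<one>\<^bsub>A\<^esub>" b] pb_one[of b] pb_one[of a] pb_skew[of a "\<one>\<^bsub>A\<^esub>"]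
  by (simp add: d_conv[symmetric] d_closed)
    (simp add: d_conv bracket_cls A.basis_vector_closed)

end

section \<open>Faithfulness of projective modules of rank one\<close>

text \<open>
Among the ideals containing \<open>I\<close>, those avoiding \<open>1\<close> are closed under unions of chains, so Zorn's lemma
applies.
\<close>
lemma (in ring) maximalideal_above:
  assumes I: "ideal I R" and proper: "\<one> \<notin> I"
  obtains P where "maximalideal P R" "I \<subseteq> P"
proof -
  let ?S = "{J. ideal J R \<and> I \<subseteq> J \<and> \<one> \<notin> J}"
  have "\<exists>P\<in>?S. \<forall>X\<in>?S. P \<subseteq> X \<longrightarrow> X = P"
  proof (rule subset_Zorn_nonempty)
    show "?S \<noteq> {}" using assms by blast
  next
    fix C assume C: "C \<noteq> {}" "subset.chain ?S C"
    then have sub: "C \<subseteq> ?S" and "subset.chain {J. ideal J R} C"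
      unfolding pred_on.chain_def by blast+
    then have "ideal (\<Union>C) R" using chain_Union_is_ideal[of C] C(1) by simp
    then show "\<Union>C \<in> ?S" using C(1) sub by blast
  qed
  then obtain P where "P \<in> ?S" and max: "\<forall>X\<in>?S. P \<subseteq> X \<longrightarrow> X = P" by (rule bexE)
  then have P: "ideal P R" "I \<subseteq> P" "\<one> \<notin> P" by simp_all
  have "maximalideal P R"
  proof (rule maximalidealI[OF P(1)])
    show "carrier R \<noteq> P" using P(3) by blast
    fix J assume J: "ideal J R" "P \<subseteq> J" "J \<subseteq> carrier R"
    show "J = P \<or> J = carrier R"
    proof (cases "\<one> \<in> J")
      case True
      then show ?thesis using ideal.one_imp_carrier[OF J(1)] by blast
    next
      case False
      then have "J \<in> ?S" using J P(2) by blast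
      then show ?thesis using max J(2) by blast
    qed
  qed
  then show ?thesis using P(2) by (rule that)
qed

lemma (in cring) annihilator_ideal:
  assumes a: "a \<in> carrier R"
  shows "ideal {s \<in> carrier R. s \<otimes> a = \<zero>} R"
proof (rule idealI[OF ring_axioms])
  show "subgroup {s \<in> carrier R. s \<otimes> a = \<zero>} (add_monoid R)"
    by (rule subgroup.intro)
      (use a in \<open>auto simp: l_distr l_minus simp flip: a_inv_def\<close>)
qed (use a in \<open>simp_all add: m_assoc, simp add: m_lcomm[of _ _ a] m_assoc[symmetric] m_comm\<close>)

text \<open>
Fractions are equivalence classes of pairs. The context provides the arithmetic of representatives
for a module \<open>M\<close> and a multiplicative subset \<open>S\<close>; for the regular module it is the arithmetic of the
localised ring.
\<close>
locale localization = module A M + submonoid S A for A (structure) and S and M (structure)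
begin

lemma S_one: "\<one>\<^bsub>A\<^esub> \<in> S" by (rule submonoid.one_closed[OF submonoid_axioms])

lemma S_closed: "s \<in> S \<Longrightarrow> s \<in> carrier A" using subset by blast

lemma mem_fraction_iff:
  assumes "m \<in> carrier M" "s \<in> S"
  shows "(m', s') \<in> fraction S M m s \<longleftrightarrow> m' \<in> carrier M \<and> s' \<in> S \<and>
    (\<exists>t\<in>S. (t \<otimes>\<^bsub>A\<^esub> s') \<odot>\<^bsub>M\<^esub> m = (t \<otimes>\<^bsub>A\<^esub> s) \<odot>\<^bsub>M\<^esub> m')"
  using assms by (auto simp: fraction_def smult_assoc1 S_closed)

lemma fraction_refl: "m \<in> carrier M \<Longrightarrow> s \<in> S \<Longrightarrow> (m, s) \<in> fraction S M m s"
  using S_one by (auto simp: mem_fraction_iff)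

lemma fraction_trans:
  assumes m: "m \<in> carrier M" "s \<in> S"
    and n: "(n, t) \<in> fraction S M m s" and p: "(p, r) \<in> fraction S M n t"
  shows "(p, r) \<in> fraction S M m s"
proof -
  obtain w where w: "n \<in> carrier M" "t \<in> S" "w \<in> S" "(w \<otimes>\<^bsub>A\<^esub> t) \<odot>\<^bsub>M\<^esub> m = (w \<otimes>\<^bsub>A\<^esub> s) \<odot>\<^bsub>M\<^esub> n"
    using n m by (auto simp: mem_fraction_iff)
  obtain v where v: "p \<in> carrier M" "r \<in> S" "v \<in> S" "(v \<otimes>\<^bsub>A\<^esub> r) \<odot>\<^bsub>M\<^esub> n = (v \<otimes>\<^bsub>A\<^esub> t) \<odot>\<^bsub>M\<^esub> p"
    using p w(1,2) by (auto simp: mem_fraction_iff)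
  note cl = S_closed[OF w(2)] S_closed[OF w(3)] S_closed[OF v(2)] S_closed[OF v(3)]
    S_closed[OF m(2)]
  have "(w \<otimes>\<^bsub>A\<^esub> v \<otimes>\<^bsub>A\<^esub> t \<otimes>\<^bsub>A\<^esub> r) \<odot>\<^bsub>M\<^esub> m = (v \<otimes>\<^bsub>A\<^esub> r) \<odot>\<^bsub>M\<^esub> ((w \<otimes>\<^bsub>A\<^esub> t) \<odot>\<^bsub>M\<^esub> m)"
    using cl m by (simp add: R.m_ac flip: smult_assoc1)
  also have "\<dots> = (w \<otimes>\<^bsub>A\<^esub> s) \<odot>\<^bsub>M\<^esub> ((v \<otimes>\<^bsub>A\<^esub> r) \<odot>\<^bsub>M\<^esub> n)"
    unfolding w(4) using cl w(1) by (simp add: R.m_ac flip: smult_assoc1)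
  also have "\<dots> = (w \<otimes>\<^bsub>A\<^esub> v \<otimes>\<^bsub>A\<^esub> t \<otimes>\<^bsub>A\<^esub> s) \<odot>\<^bsub>M\<^esub> p"
    unfolding v(4) using cl v(1) by (simp add: R.m_ac flip: smult_assoc1)
  finally have "(w \<otimes>\<^bsub>A\<^esub> v \<otimes>\<^bsub>A\<^esub> t \<otimes>\<^bsub>A\<^esub> r) \<odot>\<^bsub>M\<^esub> m = (w \<otimes>\<^bsub>A\<^esub> v \<otimes>\<^bsub>A\<^esub> t \<otimes>\<^bsub>A\<^esub> s) \<odot>\<^bsub>M\<^esub> p" .
  moreover have "w \<otimes>\<^bsub>A\<^esub> v \<otimes>\<^bsub>A\<^esub> t \<in> S" using w(2,3) v(3) by simp
  ultimately show ?thesis unfolding mem_fraction_iff[OF m] using v(1,2) by blast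
qed

lemma fraction_sym:
  assumes "m \<in> carrier M" "s \<in> S" "(n, t) \<in> fraction S M m s"
  shows "(m, s) \<in> fraction S M n t"
proof -
  have nt: "n \<in> carrier M" "t \<in> S" and "\<exists>w\<in>S. (w \<otimes>\<^bsub>A\<^esub> t) \<odot>\<^bsub>M\<^esub> m = (w \<otimes>\<^bsub>A\<^esub> s) \<odot>\<^bsub>M\<^esub> n"
    using assms(3) unfolding mem_fraction_iff[OF assms(1,2)] by blast+
  then have "\<exists>w\<in>S. (w \<otimes>\<^bsub>A\<^esub> s) \<odot>\<^bsub>M\<^esub> n = (w \<otimes>\<^bsub>A\<^esub> t) \<odot>\<^bsub>M\<^esub> m" by metis
  then show ?thesis unfolding mem_fraction_iff[OF nt] using assms(1,2) by blast
qed

lemma fraction_eqI: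
  assumes "m \<in> carrier M" "s \<in> S" "(n, t) \<in> fraction S M m s"
  shows "fraction S M n t = fraction S M m s"
proof -
  have nt: "n \<in> carrier M" "t \<in> S" using assms(3) unfolding mem_fraction_iff[OF assms(1,2)] by blast+
  show ?thesis
  proof (intro subset_antisym subrelI)
    show "(p, r) \<in> fraction S M m s" if "(p, r) \<in> fraction S M n t" for p r
      using fraction_trans[OF assms that] .
    show "(p, r) \<in> fraction S M n t" if "(p, r) \<in> fraction S M m s" for p r
      using fraction_trans[OF nt fraction_sym[OF assms] that] .
  qed
qed

text \<open>
The set on the left is the product of two fractions as it is formed in both the localised module and
the localised ring; it is a union over representatives, all of which yield the same class.
\<close>
lemma smult_fraction:
  assumes a: "a \<in> carrier A" "s \<in> S" and m: "m \<in> carrier M" "t \<in> S"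
  shows "(\<Union>(a, s)\<in>fraction S (regular_module A) a s. \<Union>(m, t)\<in>fraction S M m t.
      fraction S M (a \<odot>\<^bsub>M\<^esub> m) (s \<otimes>\<^bsub>A\<^esub> t)) = fraction S M (a \<odot>\<^bsub>M\<^esub> m) (s \<otimes>\<^bsub>A\<^esub> t)" (is "?U = ?f")
proof -
  interpret A: localization A S "regular_module A"
    by (intro localization.intro R.regular_module_is_module submonoid_axioms)
  have eq: "fraction S M (b \<odot>\<^bsub>M\<^esub> n) (r \<otimes>\<^bsub>A\<^esub> q) = ?f"
    if b: "(b, r) \<in> fraction S (regular_module A) a s" and n: "(n, q) \<in> fraction S M m t" for b r n q
  proof -
    obtain w where w: "b \<in> carrier A" "r \<in> S" "w \<in> S" "w \<otimes>\<^bsub>A\<^esub> r \<otimes>\<^bsub>A\<^esub> a = w \<otimes>\<^bsub>A\<^esub> s \<otimes>\<^bsub>A\<^esub> b"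
      using b a by (auto simp: A.mem_fraction_iff)
    obtain v where v: "n \<in> carrier M" "q \<in> S" "v \<in> S" "(v \<otimes>\<^bsub>A\<^esub> q) \<odot>\<^bsub>M\<^esub> m = (v \<otimes>\<^bsub>A\<^esub> t) \<odot>\<^bsub>M\<^esub> n"
      using n m by (auto simp: mem_fraction_iff)
    note cl = S_closed[OF w(2)] S_closed[OF w(3)] S_closed[OF v(2)] S_closed[OF v(3)]
      S_closed[OF a(2)] S_closed[OF m(2)] a(1) w(1)
    have "(w \<otimes>\<^bsub>A\<^esub> v \<otimes>\<^bsub>A\<^esub> (r \<otimes>\<^bsub>A\<^esub> q)) \<odot>\<^bsub>M\<^esub> (a \<odot>\<^bsub>M\<^esub> m)
        = (w \<otimes>\<^bsub>A\<^esub> r \<otimes>\<^bsub>A\<^esub> a) \<odot>\<^bsub>M\<^esub> ((v \<otimes>\<^bsub>A\<^esub> q) \<odot>\<^bsub>M\<^esub> m)"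
      using cl m by (simp add: R.m_ac flip: smult_assoc1)
    also have "\<dots> = (w \<otimes>\<^bsub>A\<^esub> v \<otimes>\<^bsub>A\<^esub> (s \<otimes>\<^bsub>A\<^esub> t)) \<odot>\<^bsub>M\<^esub> (b \<odot>\<^bsub>M\<^esub> n)"
      unfolding w(4) v(4) using cl v(1) by (simp add: R.m_ac flip: smult_assoc1)
    finally have eq: "(w \<otimes>\<^bsub>A\<^esub> v \<otimes>\<^bsub>A\<^esub> (r \<otimes>\<^bsub>A\<^esub> q)) \<odot>\<^bsub>M\<^esub> (a \<odot>\<^bsub>M\<^esub> m)
        = (w \<otimes>\<^bsub>A\<^esub> v \<otimes>\<^bsub>A\<^esub> (s \<otimes>\<^bsub>A\<^esub> t)) \<odot>\<^bsub>M\<^esub> (b \<odot>\<^bsub>M\<^esub> n)" .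
    have wv: "w \<otimes>\<^bsub>A\<^esub> v \<in> S" using w(3) v(3) by simp
    have am: "a \<odot>\<^bsub>M\<^esub> m \<in> carrier M" "s \<otimes>\<^bsub>A\<^esub> t \<in> S" using a m by simp_all
    have bn: "b \<odot>\<^bsub>M\<^esub> n \<in> carrier M" "r \<otimes>\<^bsub>A\<^esub> q \<in> S" using w(1,2) v(1,2) by simp_all
    have "(b \<odot>\<^bsub>M\<^esub> n, r \<otimes>\<^bsub>A\<^esub> q) \<in> ?f"
      unfolding mem_fraction_iff[OF am] using bn eq wv by blast
    then show ?thesis by (rule fraction_eqI[OF am])
  qed
  show ?thesis
  proof (intro subset_antisym subsetI)
    fix x assume "x \<in> ?U"
    then obtain b r n q where "(b, r) \<in> fraction S (regular_module A) a s"
      "(n, q) \<in> fraction S M m t" "x \<in> fraction S M (b \<odot>\<^bsub>M\<^esub> n) (r \<otimes>\<^bsub>A\<^esub> q)"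
      by blast
    then show "x \<in> ?f" by (simp only: eq)
  next
    fix x assume "x \<in> ?f"
    moreover have "(a, s) \<in> fraction S (regular_module A) a s" using a by (simp add: A.fraction_refl)
    moreover have "(m, t) \<in> fraction S M m t" using m by (simp add: fraction_refl)
    ultimately show "x \<in> ?U" by blast
  qed
qed

lemma localized_smult:
  assumes "a \<in> carrier A" "s \<in> S" "m \<in> carrier M" "t \<in> S"
  shows "fraction S (regular_module A) a s \<odot>\<^bsub>localized_module A S M\<^esub> fraction S M m t
    = fraction S M (a \<odot>\<^bsub>M\<^esub> m) (s \<otimes>\<^bsub>A\<^esub> t)"
  using smult_fraction[OF assms] by (simp add: localized_module_def)

lemma localized_mult:
  assumes "a \<in> carrier A" "s \<in> S" "b \<in> carrier A" "t \<in> S"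
  shows "fraction S (regular_module A) a s \<otimes>\<^bsub>localized_ring A S\<^esub> fraction S (regular_module A) b t
    = fraction S (regular_module A) (a \<otimes>\<^bsub>A\<^esub> b) (s \<otimes>\<^bsub>A\<^esub> t)"
proof -
  interpret A: localization A S "regular_module A"
    by (intro localization.intro R.regular_module_is_module submonoid_axioms)
  show ?thesis using A.smult_fraction[of a s b t] assms by (simp add: localized_ring_def)
qed

text \<open>
If the localised module is free on one generator \<open>m/s\<close>, then \<open>(a/1) (m/s) = 0 = (0/1) (m/s)\<close> forces
\<open>a/1 = 0/1\<close>, which says that some element of \<open>S\<close> annihilates \<open>a\<close>.
\<close>
lemma annihilator_locally_zero:
  assumes free: "free_of_rank (localized_ring A S) (localized_module A S M) 1"
    and a: "a \<in> carrier A" and kills: "\<And>m. m \<in> carrier M \<Longrightarrow> a \<odot>\<^bsub>M\<^esub> m = \<zero>\<^bsub>M\<^esub>"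
  obtains s where "s \<in> S" "s \<otimes>\<^bsub>A\<^esub> a = \<zero>\<^bsub>A\<^esub>"
proof -
  interpret A: localization A S "regular_module A"
    by (intro localization.intro R.regular_module_is_module submonoid_axioms)
  let ?L = "localized_ring A S" and ?M = "localized_module A S M"
  let ?G = "free_module ?L {..<1::nat}"
  let ?fr = "fraction S (regular_module A)"
  \<comment> \<open>The basis vector of the free module of rank one. Its image is the generator \<open>m/s\<close>.\<close>
  let ?e = "\<lambda>i::nat. if i = 0 then \<one>\<^bsub>?L\<^esub> else \<zero>\<^bsub>?L\<^esub>"
  obtain \<phi> where \<phi>: "\<phi> \<in> linear_maps ?L ?G ?M" "inj_on \<phi> (carrier ?G)"
    using free by (auto simp: free_of_rank_def bij_betw_def)
  have one: "\<one>\<^bsub>?L\<^esub> = ?fr \<one>\<^bsub>A\<^esub> \<one>\<^bsub>A\<^esub>" and zero: "\<zero>\<^bsub>?L\<^esub> = ?fr \<zero>\<^bsub>A\<^esub> \<one>\<^bsub>A\<^esub>"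
    by (simp_all add: localized_ring_def)
  have frL: "?fr b \<one>\<^bsub>A\<^esub> \<in> carrier ?L" if "b \<in> carrier A" for b
    proof -
    have "?fr b \<one>\<^bsub>A\<^esub> \<in> {?fr a s | a s. a \<in> carrier A \<and> s \<in> S}" using that S_one by blast
    then show ?thesis by (simp only: localized_ring_def ring_record_simps partial_object.select_convs)
  qed
  have inG: "(\<lambda>i. if i = 0 then ?fr b \<one>\<^bsub>A\<^esub> else \<zero>\<^bsub>?L\<^esub>) \<in> carrier ?G" if "b \<in> carrier A" for b
  proof -
    have "finite {i. (if i = (0::nat) then ?fr b \<one>\<^bsub>A\<^esub> else \<zero>\<^bsub>?L\<^esub>) \<noteq> \<zero>\<^bsub>?L\<^esub>}"
      by (rule finite_subset[of _ "{0}"]) (auto split: if_splits)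
    then show ?thesis using frL[OF that] by (simp add: free_module_def)
  qed
  have mult_e: "?fr b \<one>\<^bsub>A\<^esub> \<odot>\<^bsub>?G\<^esub> ?e = (\<lambda>i. if i = 0 then ?fr b \<one>\<^bsub>A\<^esub> else \<zero>\<^bsub>?L\<^esub>)"
    if "b \<in> carrier A" for b
    using that S_one by (auto simp: free_module_def one zero localized_mult fun_eq_iff)
  have e: "?e \<in> carrier ?G" unfolding one by (rule inG) simp
  then have "\<phi> ?e \<in> carrier ?M" using \<phi>(1) by (auto simp: linear_maps_def)
  then obtain m s where m: "m \<in> carrier M" "s \<in> S" "\<phi> ?e = fraction S M m s"
    by (auto simp: localized_module_def)
  have img: "\<phi> (?fr b \<one>\<^bsub>A\<^esub> \<odot>\<^bsub>?G\<^esub> ?e) = fraction S M (b \<odot>\<^bsub>M\<^esub> m) s" if b: "b \<in> carrier A" for b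
  proof -
    have "\<phi> (?fr b \<one>\<^bsub>A\<^esub> \<odot>\<^bsub>?G\<^esub> ?e) = ?fr b \<one>\<^bsub>A\<^esub> \<odot>\<^bsub>?M\<^esub> \<phi> ?e"
      using \<phi>(1) e frL[OF b] by (auto simp: linear_maps_def)
    then show ?thesis using b m S_one by (simp add: localized_smult S_closed)
  qed
  have "\<phi> (?fr a \<one>\<^bsub>A\<^esub> \<odot>\<^bsub>?G\<^esub> ?e) = \<phi> (?fr \<zero>\<^bsub>A\<^esub> \<one>\<^bsub>A\<^esub> \<odot>\<^bsub>?G\<^esub> ?e)"
    using a m kills by (simp only: img R.zero_closed smult_l_null)
  then have "?fr a \<one>\<^bsub>A\<^esub> \<odot>\<^bsub>?G\<^esub> ?e = ?fr \<zero>\<^bsub>A\<^esub> \<one>\<^bsub>A\<^esub> \<odot>\<^bsub>?G\<^esub> ?e"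
  proof (rule inj_onD[OF \<phi>(2)])
    show "?fr a \<one>\<^bsub>A\<^esub> \<odot>\<^bsub>?G\<^esub> ?e \<in> carrier ?G" "?fr \<zero>\<^bsub>A\<^esub> \<one>\<^bsub>A\<^esub> \<odot>\<^bsub>?G\<^esub> ?e \<in> carrier ?G"
      by (simp_all only: mult_e inG a R.zero_closed)
  qed
  from fun_cong[OF this, of 0] have "?fr a \<one>\<^bsub>A\<^esub> = ?fr \<zero>\<^bsub>A\<^esub> \<one>\<^bsub>A\<^esub>"
    by (simp only: mult_e a R.zero_closed if_True refl)
  then have "(a, \<one>\<^bsub>A\<^esub>) \<in> ?fr \<zero>\<^bsub>A\<^esub> \<one>\<^bsub>A\<^esub>" using A.fraction_refl[of a "\<one>\<^bsub>A\<^esub>"] a S_one by simp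
  then obtain w where "w \<in> S" "w \<otimes>\<^bsub>A\<^esub> a = \<zero>\<^bsub>A\<^esub>"
    using S_one by (auto simp: A.mem_fraction_iff S_closed)
  then show ?thesis by (rule that)
qed

end

text \<open>
If \<open>a\<close> kills \<open>M\<close> and \<open>a \<noteq> 0\<close>, the annihilator of \<open>a\<close> is a proper ideal and so lies in some maximal ideal
\<open>P\<close>. Localising at \<open>P\<close> produces an element outside \<open>P\<close> that annihilates \<open>a\<close>.
\<close>
lemma projective_rank_one_faithful:
  assumes M: "projective_rank_one A M" and a: "a \<in> carrier A"
    and kills: "\<And>m. m \<in> carrier M \<Longrightarrow> a \<odot>\<^bsub>M\<^esub> m = \<zero>\<^bsub>M\<^esub>"
  shows "a = \<zero>\<^bsub>A\<^esub>"
proof (rule ccontr)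
  assume "a \<noteq> \<zero>\<^bsub>A\<^esub>"
  interpret M: module A M
    using M by (simp add: projective_rank_one_def projective_module_def)
  let ?I = "{s \<in> carrier A. s \<otimes>\<^bsub>A\<^esub> a = \<zero>\<^bsub>A\<^esub>}"
  have "\<one>\<^bsub>A\<^esub> \<notin> ?I" using a \<open>a \<noteq> \<zero>\<^bsub>A\<^esub>\<close> by simp
  then obtain P where P: "maximalideal P A" "?I \<subseteq> P"
    by (rule M.R.maximalideal_above[OF M.R.annihilator_ideal[OF a]])
  interpret P: primeideal P A by (rule M.R.maximalideal_prime[OF P(1)])
  let ?S = "carrier A - P"
  have "\<one>\<^bsub>A\<^esub> \<notin> P" using P.one_imp_carrier P.I_notcarr by blast
  then have "submonoid ?S A"
    by (intro submonoid.intro) (use P.I_prime in auto)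
  then interpret L: localization A ?S M by (intro localization.intro M.module_axioms)
  have "free_of_rank (localized_ring A ?S) (localized_module A ?S M) 1"
    using M P.primeideal_axioms by (simp add: projective_rank_one_def)
  then obtain s where "s \<in> ?S" "s \<otimes>\<^bsub>A\<^esub> a = \<zero>\<^bsub>A\<^esub>"
    by (rule L.annihilator_locally_zero[OF _ a kills])
  then show False using P(2) by blast
qed

section \<open>Connections with curvature minus the Poisson form\<close>

lemma (in abelian_group) minus_minus_eq_iff:
  assumes "u \<in> carrier G" "v \<in> carrier G" "w \<in> carrier G" "t \<in> carrier G"
  shows "(u \<ominus> v) \<ominus> w = t \<longleftrightarrow> u = t \<oplus> (v \<oplus> w)"
proof -
  have "(u \<ominus> v) \<ominus> w = u \<oplus> \<ominus> (v \<oplus> w)"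
    using assms by (simp add: minus_eq minus_add a_assoc)
  then show ?thesis using assms add.inv_solve_right[of t u "v \<oplus> w"] by auto
qed

lemma restrict_scalars_simps [simp]:
  "carrier (restrict_scalars A M) = carrier M" "\<zero>\<^bsub>restrict_scalars A M\<^esub> = \<zero>\<^bsub>M\<^esub>"
  "x \<oplus>\<^bsub>restrict_scalars A M\<^esub> y = x \<oplus>\<^bsub>M\<^esub> y"
  "r \<odot>\<^bsub>restrict_scalars A M\<^esub> x = (r \<odot>\<^bsub>A\<^esub> \<one>\<^bsub>A\<^esub>) \<odot>\<^bsub>M\<^esub> x"
  "x \<ominus>\<^bsub>restrict_scalars A M\<^esub> y = x \<ominus>\<^bsub>M\<^esub> y"
  by (simp_all add: restrict_scalars_def a_minus_def a_inv_def m_inv_def)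

lemma poisson_lie_simps [simp]:
  "carrier (poisson_lie R A pb) = carrier (kaehler R A)"
  "\<zero>\<^bsub>poisson_lie R A pb\<^esub> = \<zero>\<^bsub>kaehler R A\<^esub>"
  "\<alpha> \<oplus>\<^bsub>poisson_lie R A pb\<^esub> \<beta> = \<alpha> \<oplus>\<^bsub>kaehler R A\<^esub> \<beta>"
  "a \<odot>\<^bsub>poisson_lie R A pb\<^esub> \<alpha> = a \<odot>\<^bsub>kaehler R A\<^esub> \<alpha>"
  "bracket (poisson_lie R A pb) = poisson_bracket R A pb"
  "act (poisson_lie R A pb) = poisson_action A pb"
  by (simp_all add: poisson_lie_def)

lemma poisson_lie_ext_simps [simp]:
  "carrier (poisson_lie_ext R A pb) = carrier A \<times> carrier (kaehler R A)"
  "(a, \<alpha>) \<oplus>\<^bsub>poisson_lie_ext R A pb\<^esub> (b, \<beta>) = (a \<oplus>\<^bsub>A\<^esub> b, \<alpha> \<oplus>\<^bsub>kaehler R A\<^esub> \<beta>)"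
  "c \<odot>\<^bsub>poisson_lie_ext R A pb\<^esub> (a, \<alpha>) = (c \<otimes>\<^bsub>A\<^esub> a, c \<odot>\<^bsub>kaehler R A\<^esub> \<alpha>)"
  "bracket (poisson_lie_ext R A pb) (a, \<alpha>) (b, \<beta>) =
    ((poisson_action A pb \<alpha> b \<ominus>\<^bsub>A\<^esub> poisson_action A pb \<beta> a) \<ominus>\<^bsub>A\<^esub> poisson_form A pb \<alpha> \<beta>,
     poisson_bracket R A pb \<alpha> \<beta>)"
  "act (poisson_lie_ext R A pb) (a, \<alpha>) = poisson_action A pb \<alpha>"
  by (simp_all add: poisson_lie_ext_def Let_def)

lemma extended_connection_apply [simp]:
  "extended_connection M nab (a, \<alpha>) x = a \<odot>\<^bsub>M\<^esub> x \<oplus>\<^bsub>M\<^esub> nab \<alpha> x"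
  by (simp add: extended_connection_def)

locale prequantum_module = poisson_kaehler R A pb + M: module A M
  for R :: "('r, 'x) ring_scheme" and A :: "('r, 'a, 'y) module_scheme" and pb
    and M :: "('a, 'm, 'w) module_scheme" +
  fixes nab :: "('a \<Rightarrow> 'a) set \<Rightarrow> 'm \<Rightarrow> 'm"
  assumes conn: "connection R A (poisson_lie R A pb) M nab"
    and curv: "has_curvature (poisson_lie R A pb) M nab (\<lambda>\<alpha> \<beta>. \<ominus>\<^bsub>A\<^esub> poisson_form A pb \<alpha> \<beta>)"
begin

abbreviation "E \<equiv> extended_connection M nab"

lemma nab_linear: "\<alpha> \<in> carrier D \<Longrightarrow> nab \<alpha> \<in> linear_maps R (restrict_scalars A M) (restrict_scalars A M)"
  using conn unfolding connection_def poisson_lie_simps by blast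

lemma nab_closed [simp]: "\<alpha> \<in> carrier D \<Longrightarrow> x \<in> carrier M \<Longrightarrow> nab \<alpha> x \<in> carrier M"
  using nab_linear[of \<alpha>] unfolding linear_maps_def restrict_scalars_simps by blast

lemma nab_add_arg: "\<alpha> \<in> carrier D \<Longrightarrow> x \<in> carrier M \<Longrightarrow> y \<in> carrier M
    \<Longrightarrow> nab \<alpha> (x \<oplus>\<^bsub>M\<^esub> y) = nab \<alpha> x \<oplus>\<^bsub>M\<^esub> nab \<alpha> y"
  using nab_linear[of \<alpha>] unfolding linear_maps_def restrict_scalars_simps by blast

lemma nab_scalar_arg: "\<alpha> \<in> carrier D \<Longrightarrow> r \<in> carrier R \<Longrightarrow> x \<in> carrier M
    \<Longrightarrow> nab \<alpha> ((r \<odot>\<^bsub>A\<^esub> \<one>\<^bsub>A\<^esub>) \<odot>\<^bsub>M\<^esub> x) = (r \<odot>\<^bsub>A\<^esub> \<one>\<^bsub>A\<^esub>) \<odot>\<^bsub>M\<^esub> nab \<alpha> x"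
  using nab_linear[of \<alpha>] unfolding linear_maps_def restrict_scalars_simps by blast

lemma nab_add: "\<alpha> \<in> carrier D \<Longrightarrow> \<beta> \<in> carrier D \<Longrightarrow> x \<in> carrier M
    \<Longrightarrow> nab (\<alpha> \<oplus>\<^bsub>D\<^esub> \<beta>) x = nab \<alpha> x \<oplus>\<^bsub>M\<^esub> nab \<beta> x"
  using conn unfolding connection_def poisson_lie_simps by blast

lemma nab_smult: "a \<in> carrier A \<Longrightarrow> \<alpha> \<in> carrier D \<Longrightarrow> x \<in> carrier M
    \<Longrightarrow> nab (a \<odot>\<^bsub>D\<^esub> \<alpha>) x = a \<odot>\<^bsub>M\<^esub> nab \<alpha> x"
  using conn unfolding connection_def poisson_lie_simps by blast

lemma nab_leibniz: "a \<in> carrier A \<Longrightarrow> \<alpha> \<in> carrier D \<Longrightarrow> x \<in> carrier M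
    \<Longrightarrow> nab \<alpha> (a \<odot>\<^bsub>M\<^esub> x) = poisson_action A pb \<alpha> a \<odot>\<^bsub>M\<^esub> x \<oplus>\<^bsub>M\<^esub> a \<odot>\<^bsub>M\<^esub> nab \<alpha> x"
  using conn unfolding connection_def poisson_lie_simps by blast

lemma nab_zero: "x \<in> carrier M \<Longrightarrow> nab \<zero>\<^bsub>D\<^esub> x = \<zero>\<^bsub>M\<^esub>"
  using nab_smult[of "\<zero>\<^bsub>A\<^esub>" "\<zero>\<^bsub>D\<^esub>" x] by simp

text \<open>
The curvature condition with all signs moved across, so that the later computations are rearrangements
of sums without cancellation.
\<close>
lemma nab_commutator:
  assumes "\<alpha> \<in> carrier D" "\<beta> \<in> carrier D" "x \<in> carrier M"
  shows "poisson_form A pb \<alpha> \<beta> \<odot>\<^bsub>M\<^esub> x \<oplus>\<^bsub>M\<^esub> nab \<alpha> (nab \<beta> x)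
    = nab \<beta> (nab \<alpha> x) \<oplus>\<^bsub>M\<^esub> nab (poisson_bracket R A pb \<alpha> \<beta>) x"
proof -
  have "(nab \<alpha> (nab \<beta> x) \<ominus>\<^bsub>M\<^esub> nab \<beta> (nab \<alpha> x)) \<ominus>\<^bsub>M\<^esub> nab (poisson_bracket R A pb \<alpha> \<beta>) x
      = (\<ominus>\<^bsub>A\<^esub> poisson_form A pb \<alpha> \<beta>) \<odot>\<^bsub>M\<^esub> x"
    using curv assms unfolding has_curvature_def curvature_def poisson_lie_simps by blast
  then have "nab \<alpha> (nab \<beta> x) = (\<ominus>\<^bsub>A\<^esub> poisson_form A pb \<alpha> \<beta>) \<odot>\<^bsub>M\<^esub> x
      \<oplus>\<^bsub>M\<^esub> (nab \<beta> (nab \<alpha> x) \<oplus>\<^bsub>M\<^esub> nab (poisson_bracket R A pb \<alpha> \<beta>) x)"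
    by (subst (asm) M.minus_minus_eq_iff) (simp_all add: assms bracket_closed form_closed)
  then show ?thesis
    using assms by (simp add: M.smult_l_minus form_closed bracket_closed M.r_neg2)
qed

lemma extended_connection_is_connection:
  "connection R A (poisson_lie_ext R A pb) M E"
  unfolding connection_def
proof (intro conjI ballI)
  fix \<xi> assume "\<xi> \<in> carrier (poisson_lie_ext R A pb)"
  then obtain a \<alpha> where \<xi>: "\<xi> = (a, \<alpha>)" "a \<in> carrier A" "\<alpha> \<in> carrier D" by auto
  show "E \<xi> \<in> linear_maps R (restrict_scalars A M) (restrict_scalars A M)"
    unfolding linear_maps_def restrict_scalars_simps
  proof (intro CollectI conjI ballI)
    show "E \<xi> \<in> carrier M \<rightarrow> carrier M" using \<xi> by auto
  next
    fix x y assume "x \<in> carrier M" "y \<in> carrier M"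
    then show "E \<xi> (x \<oplus>\<^bsub>M\<^esub> y) = E \<xi> x \<oplus>\<^bsub>M\<^esub> E \<xi> y"
      using \<xi> by (simp add: M.smult_r_distr nab_add_arg M.a_ac)
  next
    fix r x assume "r \<in> carrier R" "x \<in> carrier M"
    then show "E \<xi> ((r \<odot>\<^bsub>A\<^esub> \<one>\<^bsub>A\<^esub>) \<odot>\<^bsub>M\<^esub> x) = (r \<odot>\<^bsub>A\<^esub> \<one>\<^bsub>A\<^esub>) \<odot>\<^bsub>M\<^esub> E \<xi> x"
      using \<xi> by (simp add: M.smult_r_distr nab_scalar_arg A.m_comm flip: M.smult_assoc1)
  qed
  {
    fix \<eta> x assume "\<eta> \<in> carrier (poisson_lie_ext R A pb)" "x \<in> carrier M"
    then show "E (\<xi> \<oplus>\<^bsub>poisson_lie_ext R A pb\<^esub> \<eta>) x = E \<xi> x \<oplus>\<^bsub>M\<^esub> E \<eta> x"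
      using \<xi> by (auto simp: M.smult_l_distr nab_add M.a_ac)
  next
    fix r x assume "r \<in> carrier R" "x \<in> carrier M"
    then show "E (r \<odot>\<^bsub>restrict_scalars A (poisson_lie_ext R A pb)\<^esub> \<xi>) x
        = r \<odot>\<^bsub>restrict_scalars A M\<^esub> E \<xi> x"
      using \<xi> by (simp add: M.smult_r_distr nab_smult M.smult_assoc1)
  next
    fix b x assume "b \<in> carrier A" "x \<in> carrier M"
    then show "E (b \<odot>\<^bsub>poisson_lie_ext R A pb\<^esub> \<xi>) x = b \<odot>\<^bsub>M\<^esub> E \<xi> x"
      and "E \<xi> (b \<odot>\<^bsub>M\<^esub> x) = act (poisson_lie_ext R A pb) \<xi> b \<odot>\<^bsub>M\<^esub> x \<oplus>\<^bsub>M\<^esub> b \<odot>\<^bsub>M\<^esub> E \<xi> x"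
      using \<xi> by (simp_all add: M.smult_r_distr nab_smult nab_leibniz action_closed M.a_ac
          A.m_comm[of a b] flip: M.smult_assoc1)
  }
qed

text \<open>
Let \<open>z\<close> be the first component of the bracket of \<open>(a, \<alpha>)\<close> and \<open>(b, \<beta>)\<close>. Replacing \<open>\<alpha>(b)\<close> by
\<open>z + \<beta>(a) + \<pi>(\<alpha>, \<beta>)\<close> in \<open>E \<xi> (E \<eta> x)\<close> brings in exactly the term \<open>\<pi>(\<alpha>, \<beta>) x\<close> that the curvature of \<open>\<nabla>\<close>
absorbs.
\<close>
lemma extended_connection_flat:
  "flat_connection R A (poisson_lie_ext R A pb) M E"
  unfolding flat_connection_def
proof (intro conjI ballI extended_connection_is_connection)
  fix \<xi> \<eta> x
  assume "\<xi> \<in> carrier (poisson_lie_ext R A pb)" "\<eta> \<in> carrier (poisson_lie_ext R A pb)"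
    and x: "x \<in> carrier M"
  then obtain a \<alpha> b \<beta> where \<xi>: "\<xi> = (a, \<alpha>)" "a \<in> carrier A" "\<alpha> \<in> carrier D"
    and \<eta>: "\<eta> = (b, \<beta>)" "b \<in> carrier A" "\<beta> \<in> carrier D" by auto
  let ?\<alpha>b = "poisson_action A pb \<alpha> b" and ?\<beta>a = "poisson_action A pb \<beta> a"
    and ?\<pi> = "poisson_form A pb \<alpha> \<beta>" and ?c = "nab (poisson_bracket R A pb \<alpha> \<beta>) x"
  let ?z = "(?\<alpha>b \<ominus>\<^bsub>A\<^esub> ?\<beta>a) \<ominus>\<^bsub>A\<^esub> ?\<pi>"
  have cl: "?\<alpha>b \<in> carrier A" "?\<beta>a \<in> carrier A" "?\<pi> \<in> carrier A" "?c \<in> carrier M"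
    using \<xi> \<eta> x by (simp_all add: action_closed form_closed bracket_closed)
  then have z: "?z \<in> carrier A" by simp
  have "?\<alpha>b = ?z \<oplus>\<^bsub>A\<^esub> (?\<beta>a \<oplus>\<^bsub>A\<^esub> ?\<pi>)"
    using A.minus_minus_eq_iff[OF cl(1-3) z] by simp
  then have "?\<alpha>b \<odot>\<^bsub>M\<^esub> x = (?z \<oplus>\<^bsub>A\<^esub> (?\<beta>a \<oplus>\<^bsub>A\<^esub> ?\<pi>)) \<odot>\<^bsub>M\<^esub> x" by (rule arg_cong)
  then have \<alpha>b: "?\<alpha>b \<odot>\<^bsub>M\<^esub> x = ?z \<odot>\<^bsub>M\<^esub> x \<oplus>\<^bsub>M\<^esub> (?\<beta>a \<odot>\<^bsub>M\<^esub> x \<oplus>\<^bsub>M\<^esub> ?\<pi> \<odot>\<^bsub>M\<^esub> x)"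
    by (simp only: M.smult_l_distr z cl x A.a_closed)
  let ?ab = "(a \<otimes>\<^bsub>A\<^esub> b) \<odot>\<^bsub>M\<^esub> x" and ?ap = "a \<odot>\<^bsub>M\<^esub> nab \<beta> x" and ?bq = "b \<odot>\<^bsub>M\<^esub> nab \<alpha> x"
  \<comment> \<open>The terms common to the expansions of \<open>E \<xi> (E \<eta> x)\<close> and \<open>E \<eta> (E \<xi> x) + E [\<xi>, \<eta>] x\<close>.\<close>
  let ?rest = "?ab \<oplus>\<^bsub>M\<^esub> ?ap \<oplus>\<^bsub>M\<^esub> ?z \<odot>\<^bsub>M\<^esub> x \<oplus>\<^bsub>M\<^esub> ?\<beta>a \<odot>\<^bsub>M\<^esub> x \<oplus>\<^bsub>M\<^esub> ?bq"
  have mcl: "?ab \<in> carrier M" "?ap \<in> carrier M" "?bq \<in> carrier M" "?z \<odot>\<^bsub>M\<^esub> x \<in> carrier M"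
    "?\<beta>a \<odot>\<^bsub>M\<^esub> x \<in> carrier M" "?\<pi> \<odot>\<^bsub>M\<^esub> x \<in> carrier M"
    "nab \<alpha> (nab \<beta> x) \<in> carrier M" "nab \<beta> (nab \<alpha> x) \<in> carrier M"
    using \<xi> \<eta> x cl z by simp_all
  have "E \<xi> (E \<eta> x) = ?ab \<oplus>\<^bsub>M\<^esub> ?ap \<oplus>\<^bsub>M\<^esub> (?\<alpha>b \<odot>\<^bsub>M\<^esub> x \<oplus>\<^bsub>M\<^esub> ?bq \<oplus>\<^bsub>M\<^esub> nab \<alpha> (nab \<beta> x))"
    using \<xi> \<eta> x cl by (simp add: M.smult_r_distr nab_add_arg nab_leibniz flip: M.smult_assoc1)
  also have "\<dots> = ?rest \<oplus>\<^bsub>M\<^esub> (?\<pi> \<odot>\<^bsub>M\<^esub> x \<oplus>\<^bsub>M\<^esub> nab \<alpha> (nab \<beta> x))"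
    unfolding \<alpha>b using mcl by (simp only: M.a_ac M.a_closed)
  also have "\<dots> = ?rest \<oplus>\<^bsub>M\<^esub> (nab \<beta> (nab \<alpha> x) \<oplus>\<^bsub>M\<^esub> ?c)"
    by (simp only: nab_commutator[OF \<xi>(3) \<eta>(3) x])
  also have "\<dots> = (?ab \<oplus>\<^bsub>M\<^esub> ?bq \<oplus>\<^bsub>M\<^esub> (?\<beta>a \<odot>\<^bsub>M\<^esub> x \<oplus>\<^bsub>M\<^esub> ?ap \<oplus>\<^bsub>M\<^esub> nab \<beta> (nab \<alpha> x)))
      \<oplus>\<^bsub>M\<^esub> (?z \<odot>\<^bsub>M\<^esub> x \<oplus>\<^bsub>M\<^esub> ?c)"
    using mcl cl(4) by (simp only: M.a_ac M.a_closed)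
  also have "?ab \<oplus>\<^bsub>M\<^esub> ?bq \<oplus>\<^bsub>M\<^esub> (?\<beta>a \<odot>\<^bsub>M\<^esub> x \<oplus>\<^bsub>M\<^esub> ?ap \<oplus>\<^bsub>M\<^esub> nab \<beta> (nab \<alpha> x)) = E \<eta> (E \<xi> x)"
    using \<xi> \<eta> x cl
    by (simp add: M.smult_r_distr nab_add_arg nab_leibniz A.m_comm[of a b] flip: M.smult_assoc1)
  also have "?z \<odot>\<^bsub>M\<^esub> x \<oplus>\<^bsub>M\<^esub> ?c = E (bracket (poisson_lie_ext R A pb) \<xi> \<eta>) x"
    using \<xi> \<eta> by simp
  finally have "E \<xi> (E \<eta> x) = E \<eta> (E \<xi> x) \<oplus>\<^bsub>M\<^esub> E (bracket (poisson_lie_ext R A pb) \<xi> \<eta>) x" .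
  moreover have "E \<xi> (E \<eta> x) \<in> carrier M" "E \<eta> (E \<xi> x) \<in> carrier M"
    "E (bracket (poisson_lie_ext R A pb) \<xi> \<eta>) x \<in> carrier M"
    using \<xi> \<eta> x z bracket_closed by simp_all
  ultimately show "curvature (poisson_lie_ext R A pb) M E \<xi> \<eta> x = \<zero>\<^bsub>M\<^esub>"
    unfolding curvature_def by (subst M.minus_minus_eq_iff) simp_all
qed

abbreviation "\<rho> \<equiv> E \<circ> poisson_iota R A"

lemma rho_apply: "\<rho> a x = a \<odot>\<^bsub>M\<^esub> x \<oplus>\<^bsub>M\<^esub> nab (d a) x"
  by (simp add: poisson_iota_def)

lemma rho_closed: "a \<in> carrier A \<Longrightarrow> x \<in> carrier M \<Longrightarrow> \<rho> a x \<in> carrier M"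
  unfolding rho_apply by (simp add: d_closed)

lemma rho_add: "a \<in> carrier A \<Longrightarrow> b \<in> carrier A \<Longrightarrow> x \<in> carrier M
    \<Longrightarrow> \<rho> (a \<oplus>\<^bsub>A\<^esub> b) x = \<rho> a x \<oplus>\<^bsub>M\<^esub> \<rho> b x"
  unfolding rho_apply by (simp add: d_add d_closed nab_add M.smult_l_distr M.a_ac)

lemma iota_bracket:
  assumes "a \<in> carrier A" "b \<in> carrier A"
  shows "bracket (poisson_lie_ext R A pb) (poisson_iota R A a) (poisson_iota R A b)
    = poisson_iota R A (pb a b)"
proof -
  have "(pb a b \<ominus>\<^bsub>A\<^esub> pb b a) \<ominus>\<^bsub>A\<^esub> pb a b = pb a b"
    using assms pb_skew[of b a] by (simp add: A.minus_minus_eq_iff A.l_neg)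
  then show ?thesis using assms by (simp add: poisson_iota_def action_d form_d bracket_d)
qed

lemma rho_bracket:
  assumes ab: "a \<in> carrier A" "b \<in> carrier A" and x: "x \<in> carrier M"
  shows "\<rho> (pb a b) x = \<rho> a (\<rho> b x) \<ominus>\<^bsub>M\<^esub> \<rho> b (\<rho> a x)"
proof -
  have iota: "poisson_iota R A c \<in> carrier (poisson_lie_ext R A pb)" if "c \<in> carrier A" for c
    using that by (simp add: poisson_iota_def d_closed)
  have "curvature (poisson_lie_ext R A pb) M E (poisson_iota R A a) (poisson_iota R A b) x = \<zero>\<^bsub>M\<^esub>"
    using extended_connection_flat iota[OF ab(1)] iota[OF ab(2)] x
    unfolding flat_connection_def by blast
  then have "(\<rho> a (\<rho> b x) \<ominus>\<^bsub>M\<^esub> \<rho> b (\<rho> a x)) \<ominus>\<^bsub>M\<^esub> \<rho> (pb a b) x = \<zero>\<^bsub>M\<^esub>"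
    by (simp add: curvature_def iota_bracket[OF ab] comp_def)
  moreover have cl: "\<rho> a (\<rho> b x) \<in> carrier M" "\<rho> b (\<rho> a x) \<in> carrier M" "\<rho> (pb a b) x \<in> carrier M"
    by (intro rho_closed ab x pb_closed)+
  ultimately have "\<rho> a (\<rho> b x) = \<rho> b (\<rho> a x) \<oplus>\<^bsub>M\<^esub> \<rho> (pb a b) x"
    using M.minus_minus_eq_iff[OF cl M.zero_closed] M.l_zero[OF M.a_closed[OF cl(2,3)]] by metis
  then have "\<rho> a (\<rho> b x) = \<rho> (pb a b) x \<oplus>\<^bsub>M\<^esub> \<rho> b (\<rho> a x)"
    using M.a_comm[OF cl(2,3)] by metis
  then show ?thesis
    unfolding M.minus_eq using M.add.inv_solve_right[OF cl(3,1,2)] by metis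
qed

lemma rho_lie_representation:
  "lie_representation R A pb (restrict_scalars A M) \<rho>"
  unfolding lie_representation_def restrict_scalars_simps
proof (intro conjI ballI)
  fix a assume "a \<in> carrier A"
  then show "\<rho> a \<in> linear_maps R (restrict_scalars A M) (restrict_scalars A M)"
    using extended_connection_is_connection d_closed[of a]
    unfolding connection_def poisson_lie_ext_simps poisson_iota_def comp_def by blast
next
  fix r a x assume rax: "r \<in> carrier R" "a \<in> carrier A" "x \<in> carrier M"
  then have "(r \<odot>\<^bsub>A\<^esub> a) \<odot>\<^bsub>M\<^esub> x = (r \<odot>\<^bsub>A\<^esub> \<one>\<^bsub>A\<^esub>) \<odot>\<^bsub>M\<^esub> (a \<odot>\<^bsub>M\<^esub> x)"
    by (simp add: smult_conv_mult[of r a] M.smult_assoc1)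
  with rax show "\<rho> (r \<odot>\<^bsub>A\<^esub> a) x = (r \<odot>\<^bsub>A\<^esub> \<one>\<^bsub>A\<^esub>) \<odot>\<^bsub>M\<^esub> \<rho> a x"
    unfolding rho_apply
    by (simp add: d_smult d_closed nab_smult M.smult_r_distr)
qed (rule rho_add rho_bracket; assumption)+

lemma rho_scalar:
  "r \<in> carrier R \<Longrightarrow> x \<in> carrier M \<Longrightarrow> \<rho> (r \<odot>\<^bsub>A\<^esub> \<one>\<^bsub>A\<^esub>) x = (r \<odot>\<^bsub>A\<^esub> \<one>\<^bsub>A\<^esub>) \<odot>\<^bsub>M\<^esub> x"
  unfolding rho_apply by (simp add: d_scalar nab_zero)

text \<open>
Comparing \<open>\<rho> c (b x)\<close> with \<open>b (\<rho> c x)\<close> shows that \<open>c\<close> is a Casimir element. Non-degeneracy then gives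
\<open>dc = 0\<close>, so that \<open>c\<close> acts by mere multiplication and lies in the annihilator of \<open>M\<close>.
\<close>
lemma rho_kernel_trivial:
  assumes ann: "\<And>a. a \<in> carrier A \<Longrightarrow> (\<And>x. x \<in> carrier M \<Longrightarrow> a \<odot>\<^bsub>M\<^esub> x = \<zero>\<^bsub>M\<^esub>) \<Longrightarrow> a = \<zero>\<^bsub>A\<^esub>"
    and nondeg: "nondegenerate R A pb"
    and c: "c \<in> carrier A" and ker: "\<And>x. x \<in> carrier M \<Longrightarrow> \<rho> c x = \<zero>\<^bsub>M\<^esub>"
  shows "c = \<zero>\<^bsub>A\<^esub>"
proof -
  have casimir: "pb c b = \<zero>\<^bsub>A\<^esub>" if b: "b \<in> carrier A" for b
  proof (rule ann)
    fix x assume x: "x \<in> carrier M"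
    have "\<rho> c (b \<odot>\<^bsub>M\<^esub> x) = pb c b \<odot>\<^bsub>M\<^esub> x \<oplus>\<^bsub>M\<^esub> b \<odot>\<^bsub>M\<^esub> \<rho> c x"
      unfolding rho_apply using b c x
      by (simp add: nab_leibniz d_closed action_d M.smult_r_distr A.m_comm[of c b] M.a_ac
          flip: M.smult_assoc1)
    then show "pb c b \<odot>\<^bsub>M\<^esub> x = \<zero>\<^bsub>M\<^esub>"
      using ker[OF x] ker[OF M.smult_closed[OF b x]] b c x by simp
  qed (use b c in simp)
  have "restrict (poisson_form A pb (d c)) (carrier D) = restrict (poisson_form A pb (d \<zero>\<^bsub>A\<^esub>)) (carrier D)"
    using form_d_casimir[OF c casimir] form_d_casimir[OF A.zero_closed pb_zero]
    by (intro restrict_ext) simp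
  then have "d c = \<zero>\<^bsub>D\<^esub>"
    using nondeg d_closed[OF c] d_closed[OF A.zero_closed]
    unfolding nondegenerate_def inj_on_def d_zero by blast
  then show ?thesis
    using ker c unfolding rho_apply by (intro ann) (simp_all add: nab_zero)
qed

end

theorem theorem4p3:
  fixes R :: "('r, 'x) ring_scheme"
    and A :: "('r, 'a, 'y) module_scheme"
    and pb :: "'a \<Rightarrow> 'a \<Rightarrow> 'a"
    and M :: "('a, 'm, 'w) module_scheme"
    and nab :: "('a \<Rightarrow> 'a) set \<Rightarrow> 'm \<Rightarrow> 'm"
  assumes "poisson_algebra R A pb"
    and "representing_pair R A pb M nab"
  shows "flat_connection R A (poisson_lie_ext R A pb) M (extended_connection M nab) \<and>
    lie_representation R A pb (restrict_scalars A M) (extended_connection M nab \<circ> poisson_iota R A) \<and>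
    (\<forall>r\<in>carrier R. \<forall>x\<in>carrier M.
      (extended_connection M nab \<circ> poisson_iota R A) (r \<odot>\<^bsub>A\<^esub> \<one>\<^bsub>A\<^esub>) x
        = r \<odot>\<^bsub>restrict_scalars A M\<^esub> x) \<and>
    (\<forall>a\<in>carrier A. \<forall>x\<in>carrier M.
      (extended_connection M nab \<circ> poisson_iota R A) a x
        = nab (kaehler_d R A a) x \<oplus>\<^bsub>M\<^esub> (a \<odot>\<^bsub>M\<^esub> x)) \<and>
    (nondegenerate R A pb \<longrightarrow>
      faithful A (restrict_scalars A M) (extended_connection M nab \<circ> poisson_iota R A))"
proof -
  have rank_one: "projective_rank_one A M"
    using assms(2) by (simp add: representing_pair_def)
  have alg: "algebra R A" using assms(1) by (rule poisson_algebra.axioms(1))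
  interpret prequantum_module R A pb M nab
  proof (intro prequantum_module.intro prequantum_module_axioms.intro poisson_kaehler.intro
      kaehler_algebra.intro)
    show "cring A" "algebra R A" "poisson_algebra R A pb"
      using algebra.M_cring[OF alg] alg assms(1) by this
    show "module A M" using rank_one by (simp add: projective_rank_one_def projective_module_def)
  qed (use assms(2) in \<open>simp_all add: representing_pair_def\<close>)
  have faithful: "faithful A (restrict_scalars A M) \<rho>" if "nondegenerate R A pb"
    unfolding faithful_def
  proof (rule inj_onI)
    fix a b assume ab: "a \<in> carrier A" "b \<in> carrier A"
      and eq: "restrict (\<rho> a) (carrier (restrict_scalars A M))
        = restrict (\<rho> b) (carrier (restrict_scalars A M))"
    have "a \<ominus>\<^bsub>A\<^esub> b = \<zero>\<^bsub>A\<^esub>"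
    proof (rule rho_kernel_trivial[OF projective_rank_one_faithful[OF rank_one] that])
      fix x assume x: "x \<in> carrier M"
      have "\<rho> (a \<ominus>\<^bsub>A\<^esub> b) x \<oplus>\<^bsub>M\<^esub> \<rho> b x = \<rho> ((a \<ominus>\<^bsub>A\<^esub> b) \<oplus>\<^bsub>A\<^esub> b) x"
        by (rule rho_add[symmetric]) (simp_all add: ab x)
      also have "(a \<ominus>\<^bsub>A\<^esub> b) \<oplus>\<^bsub>A\<^esub> b = a" using ab by (simp add: a_minus_def A.a_assoc A.l_neg)
      also have "\<rho> a x = \<rho> b x" using fun_cong[OF eq, of x] x by simp
      finally show "\<rho> (a \<ominus>\<^bsub>A\<^esub> b) x = \<zero>\<^bsub>M\<^esub>"
        using M.add.r_cancel_one[OF rho_closed[OF ab(2) x] rho_closed[OF A.minus_closed[OF ab] x]]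
        by simp
    qed (use ab in simp_all)
    then show "a = b" using ab by simp
  qed
  have "\<rho> a x = nab (d a) x \<oplus>\<^bsub>M\<^esub> a \<odot>\<^bsub>M\<^esub> x" if "a \<in> carrier A" "x \<in> carrier M" for a x
    unfolding rho_apply using that by (simp add: M.a_comm d_closed)
  then show ?thesis
    unfolding restrict_scalars_simps
    using extended_connection_flat rho_lie_representation rho_scalar faithful by blast
qed

end
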